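(* Let $K,M,N\ge1$, $q\in\mathbf{N}$ with $M\asymp N$ and $N^{\eta}\le K$ for some $\eta>0$. Assume $q\le N^{2-\delta}$ for some $\delta>0$ and $\rho\in\mathbf{Z}$ with $(\rho,q)=1$. Then for any $\varepsilon>0$, \[ \sum_{s=1}^{q}\Big(\sum_{r\le K}\ \sum_{m\equiv\rho r+s\ (\mathrm{mod}\ q)}\tau_{M,N}(m)-\frac{KMN}{q}\Big)^2\ll\frac{K^2N^{\max(7/2,\,4-\delta,\,4-\eta)+\varepsilon}}{q}. \]
   Context: $\tau_{M,N}(m)=\#\{(a,b)\in\mathbf{N}^2: a\le M,\ b\le N,\ ab=m\}$; $r$ and $m$ range over positive integers. *)

theory Defs
  imports "HOL-Analysis.Analysis" "HOL-Number_Theory.Cong"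
begin

definition tau_trunc :: "real \<Rightarrow> real \<Rightarrow> nat \<Rightarrow> nat" where
  "tau_trunc M N m =
     card {(a :: nat, b :: nat). 1 \<le> a \<and> 1 \<le> b \<and> real a \<le> M \<and> real b \<le> N \<and> a * b = m}"

text \<open>
  The sum over the residue class runs over infinitely many positive integers m, but only
  finitely many summands are nonzero. It is written as an infinite sum because the finite-sum
  operator would return 0 on an infinite index set.
\<close>
definition tau_progression_sum :: "real \<Rightarrow> real \<Rightarrow> nat \<Rightarrow> int \<Rightarrow> real" where
  "tau_progression_sum M N q a =
     (\<Sum>\<^sub>\<infinity>m \<in> {m :: nat. 1 \<le> m \<and> [int m = a] (mod int q)}. real (tau_trunc M N m))"

end

theory Submission
  imports Defs
begin

text \<open>
  By Parseval modulo \<open>q\<close>, the variance of the counts is \<open>1/q\<close> times the sum of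
  \<open>|A(h)|\<^sup>2 |B(h)|\<^sup>2\<close> over the frequencies \<open>h \<noteq> 0\<close>, where \<open>A(h)\<close> is the sum of \<open>e(hab/q)\<close> over
  \<open>a \<le> M\<close>, \<open>b \<le> N\<close> and \<open>B(h)\<close> is the sum of \<open>e(-\<rho>hr/q)\<close> over \<open>r \<le> K\<close>.
  Approximate \<open>h/q = u/v + x/(qv)\<close> with \<open>v \<le> 2M\<close> and \<open>|x| \<le> q/(2M)\<close>. Up to logarithms, the
  terms with \<open>v\<close> not dividing \<open>a\<close> contribute \<open>O(M)\<close> to \<open>A(h)\<close>, and the square of the contribution
  of the other terms is at most \<open>MNq/(v|x|)\<close>, or \<open>(MN/v)\<^sup>2\<close> if \<open>x = 0\<close>.
  If \<open>j\<close> is the residue of \<open>\<rho>h\<close> of least absolute value, then \<open>|B(h)| \<le> min(K, q/|j|)\<close> and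
  \<open>jv \<equiv> \<rho>x\<close> modulo \<open>q\<close>. Hence \<open>h\<close> is determined by \<open>x\<close>, the integer quotient of \<open>jv\<close> by \<open>q\<close>, and
  the divisor \<open>j\<close> of \<open>jv\<close>, so by the divisor bound the sum over \<open>h\<close> is at most
  \<open>K\<^sup>2N\<^sup>2q + KN\<^sup>4\<close> up to a factor \<open>N\<^sup>\<epsilon>\<close>. The exponents \<open>4 - \<delta>\<close> and \<open>4 - \<eta>\<close> come from these
  two terms.
\<close>

section \<open>Divisors and harmonic sums\<close>

text \<open>Each divisor factors as \<open>p ^ i * e\<close> with \<open>i \<le> a\<close> and
  \<open>e\<close> dividing \<open>n\<close>, so the divisors are covered by the image of a product
  set.\<close>

lemma card_divisors_prime_power_mult_le:
  fixes p n :: nat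
  assumes "prime p" "n > 0"
  shows "card {d. d dvd p ^ a * n} \<le> (a + 1) * card {d. d dvd n}"
proof -
  have "{d. d dvd p ^ a * n} \<subseteq> (\<lambda>(i, e). p ^ i * e) ` ({..a} \<times> {d. d dvd n})"
  proof
    fix d assume "d \<in> {d. d dvd p ^ a * n}"
    then obtain x y where xy: "d = x * y" "x dvd p ^ a" "y dvd n"
      using division_decomp by blast
    then obtain i where "i \<le> a" "x = p ^ i"
      using divides_primepow_nat[OF assms(1)] by blast
    with xy show "d \<in> (\<lambda>(i, e). p ^ i * e) ` ({..a} \<times> {d. d dvd n})"
      by force
  qed
  then have "card {d. d dvd p ^ a * n} \<le> card ({..a} \<times> {d. d dvd n})"
    using assms(2) by (intro surj_card_le) auto
  then show ?thesis
    by (simp add: card_cartesian_product)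
qed

text \<open>One prime power is stripped off at a time. A prime \<open>p\<close> with
  \<open>p powr \<epsilon> \<ge> 2\<close> costs nothing, since \<open>a + 1 \<le> 2 ^ a\<close>;
  each of the finitely many smaller primes costs a constant factor \<open>B\<close>.\<close>

lemma card_divisors_bound:
  fixes \<epsilon> :: real
  assumes "\<epsilon> > 0"
  shows "\<exists>C\<ge>1. \<forall>n>0. real (card {d::nat. d dvd n}) \<le> C * real n powr \<epsilon>"
proof -
  \<comment> \<open>With this \<open>B\<close>, the number \<open>a + 1\<close> is at most
    \<open>B * (1 + a * \<epsilon> * ln 2)\<close>, and the bracket is at most
    \<open>(2 ^ a) powr \<epsilon>\<close>.\<close>
  define B where "B = 1 + 1 / (\<epsilon> * ln 2)"
  define P where "P = {p::nat. real p < 2 powr (1 / \<epsilon>)}"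
  have [simp]: "finite P"
    by (rule finite_subset[of _ "{..nat \<lceil>2 powr (1 / \<epsilon>)\<rceil>}"]) (auto simp: P_def, linarith)
  have "B \<ge> 1"
    using assms by (simp add: B_def)
  have small: "real (a + 1) \<le> B * real (p ^ a) powr \<epsilon>" if "prime p" for p a :: nat
  proof -
    have "p \<ge> 2"
      using that prime_ge_2_nat by blast
    have "1 + real a * (\<epsilon> * ln 2) \<le> exp (real a * (\<epsilon> * ln 2))"
      by (rule exp_ge_add_one_self)
    also have "\<dots> = (2 ^ a) powr \<epsilon>"
      by (simp add: powr_def ln_realpow mult_ac)
    finally have *: "1 + real a * (\<epsilon> * ln 2) \<le> (2 ^ a) powr \<epsilon>" .
    have "real (a + 1) \<le> B * (1 + real a * (\<epsilon> * ln 2))"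
      using assms by (simp add: B_def field_simps)
    also have "\<dots> \<le> B * (2 ^ a) powr \<epsilon>"
      using * \<open>B \<ge> 1\<close> by (intro mult_left_mono) auto
    also have "\<dots> \<le> B * real (p ^ a) powr \<epsilon>"
      using \<open>p \<ge> 2\<close> \<open>B \<ge> 1\<close> assms
      by (intro mult_left_mono powr_mono2) (auto intro!: power_mono)
    finally show ?thesis .
  qed
  have large: "real (a + 1) \<le> real (p ^ a) powr \<epsilon>" if "prime p" "p \<notin> P" for p a :: nat
  proof -
    have "p \<ge> 2"
      using that prime_ge_2_nat by blast
    have "2 = (2 powr (1 / \<epsilon>)) powr \<epsilon>"
      using assms by (simp add: powr_powr)
    also have "\<dots> \<le> real p powr \<epsilon>"
      using that assms by (intro powr_mono2) (auto simp: P_def)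
    finally have "2 ^ a \<le> (real p powr \<epsilon>) ^ a"
      by (intro power_mono) auto
    also have "\<dots> = real (p ^ a) powr \<epsilon>"
      using \<open>p \<ge> 2\<close> by (simp add: powr_realpow[symmetric] powr_powr mult_ac)
    finally have "2 ^ a \<le> real (p ^ a) powr \<epsilon>" .
    moreover have "real (a + 1) \<le> real (2 ^ a)"
      unfolding of_nat_le_iff using less_exp[of a] by linarith
    ultimately show ?thesis
      by simp
  qed
  \<comment> \<open>Recording only the small primes that divide \<open>n\<close> in the exponent of
    \<open>B\<close> lets the induction close; the exponent is replaced by \<open>card P\<close> at
    the end.\<close>
  have main: "real (card {d. d dvd n}) \<le> B ^ card (P \<inter> prime_factors n) * real n powr \<epsilon>"
    if "n > 0" for n :: nat
    using that
  proof (induction n rule: less_induct)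
    case (less n)
    show ?case
    proof (cases "n = 1")
      case True
      then show ?thesis by simp
    next
      case False
      then obtain p where p: "prime p" "p dvd n"
        using prime_factor_nat by blast
      define a where "a = multiplicity p n"
      obtain n' where n': "n = p ^ a * n'" "\<not> p dvd n'"
        using less.prems p unfolding a_def
        by (metis multiplicity_decompose' not_prime_unit not_gr_zero)
      have "a > 0"
        using n' p by (cases a) auto
      have "n' > 0"
        using less.prems n' by (cases n') auto
      have "p ^ a > 1"
        using one_less_power[OF prime_gt_1_nat[OF p(1)] \<open>a > 0\<close>] .
      then have "n' < n"
        using \<open>n' > 0\<close> n'(1) by simp
      have pf: "prime_factors n = insert p (prime_factors n')"
        using p \<open>a > 0\<close> \<open>n' > 0\<close> n'(1)
        by (auto simp: prime_factors_product prime_factorization_prime_power prime_prime_factors)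
      have pn: "p \<notin> prime_factors n'"
        using n'(2) by auto
      have IH: "real (card {d. d dvd n'}) \<le> B ^ card (P \<inter> prime_factors n') * real n' powr \<epsilon>"
        using less.IH \<open>n' < n\<close> \<open>n' > 0\<close> by blast
      have step: "real (a + 1) * B ^ card (P \<inter> prime_factors n')
          \<le> B ^ card (P \<inter> prime_factors n) * real (p ^ a) powr \<epsilon>"
      proof (cases "p \<in> P")
        case True
        then have "card (P \<inter> prime_factors n) = Suc (card (P \<inter> prime_factors n'))"
          using pn by (simp add: pf)
        then show ?thesis
          using mult_right_mono[OF small[OF p(1), of a], of "B ^ card (P \<inter> prime_factors n')"] \<open>B \<ge> 1\<close>
          by (simp add: mult_ac)
      next
        case F: False
        then have "card (P \<inter> prime_factors n) = card (P \<inter> prime_factors n')"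
          by (simp add: pf)
        then show ?thesis
          using mult_right_mono[OF large[OF p(1) F, of a], of "B ^ card (P \<inter> prime_factors n')"] \<open>B \<ge> 1\<close>
          by (simp add: mult_ac)
      qed
      have "real (card {d. d dvd n}) \<le> real (a + 1) * real (card {d. d dvd n'})"
        using card_divisors_prime_power_mult_le[OF p(1) \<open>n' > 0\<close>, of a] n'(1)
        by (metis of_nat_le_iff of_nat_mult)
      also have "\<dots> \<le> real (a + 1) * (B ^ card (P \<inter> prime_factors n') * real n' powr \<epsilon>)"
        by (intro mult_left_mono IH) auto
      also have "\<dots> \<le> B ^ card (P \<inter> prime_factors n) * real (p ^ a) powr \<epsilon> * real n' powr \<epsilon>"
        using mult_right_mono[OF step, of "real n' powr \<epsilon>"] by (simp add: mult_ac)
      also have "\<dots> = B ^ card (P \<inter> prime_factors n) * real n powr \<epsilon>"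
        unfolding n'(1) by (simp add: powr_mult)
      finally show ?thesis .
    qed
  qed
  show ?thesis
  proof (intro exI[of _ "B ^ card P"] conjI allI impI)
    show "1 \<le> B ^ card P"
      using \<open>B \<ge> 1\<close> by simp
    fix n :: nat assume "n > 0"
    have "B ^ card (P \<inter> prime_factors n) \<le> B ^ card P"
      using \<open>B \<ge> 1\<close> by (intro power_increasing card_mono) auto
    then show "real (card {d. d dvd n}) \<le> B ^ card P * real n powr \<epsilon>"
      using main[OF \<open>n > 0\<close>] by (meson mult_right_mono order_trans powr_ge_zero)
  qed
qed

section \<open>Harmonic sums and elementary inequalities\<close>

lemma harm_le_one_plus_ln: "n > 0 \<Longrightarrow> harm n \<le> 1 + ln (real n)"
proof -
  assume "n > 0"
  then obtain k where "n = Suc k" by (cases n) auto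
  then show ?thesis
    using decseqD[OF decseq_harm_diff_ln, of 0 k] by (simp add: harm_expand)
qed

text \<open>Trades logarithms for a small power, which is later absorbed into
  \<open>N powr \<epsilon>\<close>. The condition \<open>a \<le> 1\<close> lets the constant term 1
  be absorbed as well.\<close>

lemma harm_le_powr:
  assumes "0 < a" "a \<le> 1" "n > 0"
  shows "harm n \<le> 2 / a * real n powr a"
proof -
  have "harm n \<le> 1 + ln (real n)"
    using assms harm_le_one_plus_ln by blast
  also have "ln (real n) \<le> real n powr a / a"
    using assms by (intro ln_powr_bound) auto
  also have "1 \<le> real n powr a / a"
    using assms ge_one_powr_ge_zero[of "real n" a] by (simp add: field_simps)
  finally show ?thesis by simp
qed

lemma harm_conv_sum_divide: "harm n = (\<Sum>i=1..n. 1 / real i)"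
  by (simp add: harm_def inverse_eq_divide)

lemma sum_inverse_abs_le_harm:
  fixes A :: "int set"
  assumes "A \<subseteq> {x. x \<noteq> 0 \<and> \<bar>x\<bar> \<le> int n}"
  shows "(\<Sum>x\<in>A. 1 / \<bar>real_of_int x\<bar>) \<le> 2 * harm n"
proof -
  have *: "{x. x \<noteq> 0 \<and> \<bar>x\<bar> \<le> int n} = int ` {1..n} \<union> (\<lambda>i. - int i) ` {1..n}" (is "?L = ?R")
  proof
    show "?L \<subseteq> ?R"
    proof
      fix x assume "x \<in> ?L"
      then have "x = int (nat x) \<and> nat x \<in> {1..n} \<or> x = - int (nat (- x)) \<and> nat (- x) \<in> {1..n}"
        by auto
      then show "x \<in> ?R"
        by blast
    qed
  qed auto
  have "(\<Sum>x\<in>A. 1 / \<bar>real_of_int x\<bar>) \<le> (\<Sum>x\<in>?L. 1 / \<bar>real_of_int x\<bar>)"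
    using assms by (intro sum_mono2) (auto simp: *)
  also have "\<dots> = (\<Sum>x\<in>int ` {1..n}. 1 / \<bar>real_of_int x\<bar>) + (\<Sum>x\<in>(\<lambda>i. - int i) ` {1..n}. 1 / \<bar>real_of_int x\<bar>)"
    unfolding * by (intro sum.union_disjoint) auto
  also have "\<dots> = 2 * harm n"
    by (simp add: sum.reindex inj_on_def harm_conv_sum_divide)
  finally show ?thesis .
qed

text \<open>Telescoping: each term is at most \<open>2 * (sqrt i - sqrt (i - 1))\<close>.\<close>

lemma sum_inverse_sqrt_le: "(\<Sum>i=1..n. 1 / sqrt (real i)) \<le> 2 * sqrt (real n)"
proof (induction n)
  case (Suc n)
  have "1 / sqrt (real (Suc n)) \<le> 2 * (sqrt (real (Suc n)) - sqrt (real n))"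
  proof -
    have "(sqrt (real (Suc n)) - sqrt (real n)) * (sqrt (real (Suc n)) + sqrt (real n)) = 1"
      by (simp add: algebra_simps)
    moreover have "sqrt (real (Suc n)) + sqrt (real n) \<le> 2 * sqrt (real (Suc n))"
      by simp
    ultimately have "1 \<le> (sqrt (real (Suc n)) - sqrt (real n)) * (2 * sqrt (real (Suc n)))"
      by (metis mult_left_mono diff_ge_0_iff_ge of_nat_le_iff real_sqrt_le_iff le_SucI order_refl)
    then show ?thesis
      by (simp add: field_simps)
  qed
  with Suc show ?case by simp
qed auto

lemma power2_sum_le: "(a + b)\<^sup>2 \<le> 2 * a\<^sup>2 + 2 * b\<^sup>2" for a b :: real
  using sum_squares_bound[of a b] by (simp add: power2_sum)

section \<open>Exponential sums\<close>

text \<open>The standard additive character \<open>e(t)\<close>, of period 1.\<close>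

definition unit_exp :: "real \<Rightarrow> complex" where
  "unit_exp t = cis (2 * pi * t)"

lemma norm_unit_exp [simp]: "norm (unit_exp t) = 1"
  by (simp add: unit_exp_def)

lemma unit_exp_0 [simp]: "unit_exp 0 = 1"
  by (simp add: unit_exp_def)

lemma unit_exp_add: "unit_exp (s + t) = unit_exp s * unit_exp t"
  by (simp add: unit_exp_def cis_mult distrib_left)

lemma unit_exp_uminus: "unit_exp (- t) = cnj (unit_exp t)"
  by (simp add: unit_exp_def cis_cnj)

lemma unit_exp_mult_of_nat: "unit_exp (real n * t) = unit_exp t ^ n"
  by (simp add: unit_exp_def Complex.DeMoivre mult_ac)

lemma unit_exp_of_int [simp]: "unit_exp (of_int n) = 1"
  by (simp add: unit_exp_def cis_multiple_2pi)

lemma unit_exp_diff_of_int: "unit_exp (t - of_int n) = unit_exp t"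
  using unit_exp_add[of t "of_int (- n)"] unit_exp_of_int[of "- n"] by simp

text \<open>On the interval from 0 to \<open>y / 2\<close>, which lies below \<open>pi / 4\<close>,
  the cosine is at least \<open>sqrt 2 / 2\<close>. The mean value theorem then bounds
  \<open>sin (y / 2)\<close> from below, and the double angle formula returns to
  \<open>y\<close>.\<close>

lemma sin_ge_half_self:
  assumes "0 \<le> y" "y \<le> pi / 2"
  shows "y / 2 \<le> sin y"
proof (cases "y = 0")
  case False
  with assms have "0 < y / 2" by simp
  then obtain z where z: "0 < z" "z < y / 2" "sin (y / 2) - sin 0 = (y / 2 - 0) * cos z"
    using MVT2[of 0 "y / 2" sin cos] by (auto intro: DERIV_sin)
  have c: "sqrt 2 / 2 \<le> cos w" if "0 \<le> w" "w \<le> y / 2" for w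
    using cos_monotone_0_pi_le[of w "pi / 4"] that assms by (simp add: cos_45)
  have "y / 2 = 2 * (y / 2 * (sqrt 2 / 2)) * (sqrt 2 / 2)"
    by simp
  also have "\<dots> \<le> 2 * (y / 2 * cos z) * cos (y / 2)"
    using c[of z] c[of "y / 2"] z assms by (intro mult_mono mult_nonneg_nonneg) (auto intro: order_trans[of 0 "sqrt 2 / 2"])
  also have "\<dots> = sin y"
    using z(3) sin_double[of "y / 2"] by simp
  finally show ?thesis .
qed auto

text \<open>The norm equals \<open>2 * \<bar>sin (pi * t)\<bar>\<close>, the length of a chord of
  the unit circle.\<close>

lemma norm_one_minus_unit_exp_ge:
  assumes "\<bar>t\<bar> \<le> 1 / 2"
  shows "2 * \<bar>t\<bar> \<le> norm (1 - unit_exp t)"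
proof -
  have "(norm (1 - unit_exp t))\<^sup>2 = (1 - cos (2 * pi * t))\<^sup>2 + (sin (2 * pi * t))\<^sup>2"
    by (simp add: unit_exp_def cmod_power2)
  also have "\<dots> = 2 * (1 - cos (2 * (pi * t)))"
    using sin_cos_squared_add[of "2 * pi * t"] by (simp add: power2_eq_square algebra_simps)
  also have "\<dots> = (2 * \<bar>sin (pi * t)\<bar>)\<^sup>2"
    by (simp add: cos_double_sin power_mult_distrib)
  finally have n: "norm (1 - unit_exp t) = 2 * \<bar>sin (pi * t)\<bar>"
    by (rule power2_eq_imp_eq) auto
  have "\<bar>sin (pi * t)\<bar> \<ge> \<bar>sin (pi * \<bar>t\<bar>)\<bar>"
    by (cases "t \<ge> 0") auto
  moreover have "sin (pi * \<bar>t\<bar>) \<ge> pi * \<bar>t\<bar> / 2"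
    using assms by (intro sin_ge_half_self) (auto simp: field_simps)
  moreover have "2 * \<bar>t\<bar> \<le> pi * \<bar>t\<bar>"
    using pi_ge_two by (intro mult_right_mono) auto
  ultimately show ?thesis
    unfolding n by linarith
qed

text \<open>The distance to the nearest integer, usually written \<open>||t||\<close>.\<close>

definition int_dist :: "real \<Rightarrow> real" where
  "int_dist t = \<bar>t - of_int (round t)\<bar>"

lemma int_dist_le_half: "int_dist t \<le> 1 / 2"
  unfolding int_dist_def using of_int_round_abs_le[of t] by (simp add: abs_minus_commute)

lemma int_dist_eqI: "\<bar>t - of_int z\<bar> < 1 / 2 \<Longrightarrow> int_dist t = \<bar>t - of_int z\<bar>"
  using round_unique'[of t z] by (simp add: int_dist_def)

lemma norm_sum_unit_exp_le: "norm (\<Sum>b=1..n. unit_exp (real b * t)) \<le> real n"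
  using norm_sum[of "\<lambda>b. unit_exp (real b * t)" "{1..n}"] by simp

text \<open>After \<open>t\<close> is shifted by its nearest integer, the geometric sum has a
  numerator of norm at most 2 and a denominator of norm at least \<open>2 * int_dist t\<close>. The
  product form also covers integers \<open>t\<close>, where the denominator vanishes.\<close>

lemma norm_sum_unit_exp_mult_int_dist_le:
  "norm (\<Sum>b=1..n. unit_exp (real b * t)) * int_dist t \<le> 1"
proof -
  define s where "s = t - of_int (round t)"
  define z where "z = unit_exp s"
  have s: "\<bar>s\<bar> \<le> 1 / 2" "int_dist t = \<bar>s\<bar>"
    using int_dist_le_half[of t] by (simp_all add: s_def int_dist_def)
  have "unit_exp (real b * t) = z ^ b" for b
    using unit_exp_mult_of_nat[of b t] unit_exp_diff_of_int[of t "round t"] by (simp add: z_def s_def)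
  then have eq: "(\<Sum>b=1..n. unit_exp (real b * t)) = (\<Sum>b=1..n. z ^ b)"
    by simp
  have "(1 - z) * (\<Sum>b=1..n. z ^ b) = z - z ^ Suc n"
    using sum_gp_multiplied[of 1 n z] by (cases "n = 0") auto
  moreover have "norm (z - z ^ Suc n) \<le> 2"
    using norm_triangle_ineq4[of z "z ^ Suc n"] by (simp add: z_def norm_mult norm_power)
  ultimately have "norm (1 - z) * norm (\<Sum>b=1..n. z ^ b) \<le> 2"
    by (metis norm_mult)
  moreover have "2 * \<bar>s\<bar> * norm (\<Sum>b=1..n. z ^ b) \<le> norm (1 - z) * norm (\<Sum>b=1..n. z ^ b)"
    unfolding z_def by (intro mult_right_mono norm_one_minus_unit_exp_ge s) auto
  ultimately show ?thesis
    unfolding eq s by (simp add: mult_ac)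
qed

section \<open>Orthogonality and the variance identity modulo \<open>q\<close>\<close>

lemma sum_unit_exp_residues:
  assumes "q > 0"
  shows "(\<Sum>h<q. unit_exp (real h * (of_int d / real q))) = (if int q dvd d then of_nat q else 0)"
proof -
  define z where "z = unit_exp (of_int d / real q)"
  have eq: "(\<Sum>h<q. unit_exp (real h * (of_int d / real q))) = (\<Sum>h<q. z ^ h)"
    by (simp only: z_def unit_exp_mult_of_nat)
  have "z ^ q = 1"
    using unit_exp_mult_of_nat[of q "of_int d / real q"] assms by (simp add: z_def)
  show ?thesis
  proof (cases "int q dvd d")
    case True
    then obtain e where "d = int q * e" by blast
    then have "z = unit_exp (of_int e)"
      using assms by (simp add: z_def)
    then show ?thesis
      using True eq by simp
  next
    case False
    have "z \<noteq> 1"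
    proof
      assume "z = 1"
      then have "cis (2 * pi * (of_int d / real q)) = cis 0"
        by (simp add: z_def unit_exp_def)
      then have "cos (2 * pi * (of_int d / real q)) = 1"
        by (simp add: cis.ctr complex_eq_iff)
      then obtain x :: int where "2 * pi * (of_int d / real q) = of_int x * 2 * pi"
        using cos_one_2pi_int by auto
      then have "of_int d = real_of_int (int q * x)"
        using assms by (simp add: field_simps)
      then have "d = int q * x"
        by (simp only: of_int_eq_iff)
      with False show False by simp
    qed
    then have "(\<Sum>h<q. z ^ h) = 0"
      using \<open>z ^ q = 1\<close> by (simp add: geometric_sum)
    then show ?thesis
      using False eq by simp
  qed
qed

text \<open>Parseval for the counting function of the residues \<open>c i\<close>. The frequency 0
  contributes \<open>(card I)\<^sup>2\<close>, and subtracting the mean removes exactly this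
  term.\<close>

lemma sum_variance_residues:
  fixes c :: "'a \<Rightarrow> int" and q :: nat
  assumes "finite I" "q > 0"
  shows "(\<Sum>s=1..q. (real (card {i \<in> I. [c i = int s] (mod int q)}) - real (card I) / real q)\<^sup>2)
    = (\<Sum>h=1..<q. (norm (\<Sum>i\<in>I. unit_exp (real h * (of_int (c i) / real q))))\<^sup>2) / real q"
proof -
  define S where "S s = real (card {i \<in> I. [c i = int s] (mod int q)})" for s
  define T where "T h = (\<Sum>i\<in>I. unit_exp (real h * (of_int (c i) / real q)))" for h
  have S: "S s = (\<Sum>i\<in>I. of_bool ([c i = int s] (mod int q)))" for s
    using assms(1) by (simp add: S_def sum.If_cases of_bool_def Int_def)
  have ex1: "(\<Sum>s=1..q. of_bool ([a = int s] (mod int q) \<and> [b = int s] (mod int q)))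
     = (of_bool ([a = b] (mod int q)) :: real)" for a b :: int
  proof -
    define x where "x = a mod int q"
    \<comment> \<open>As \<open>s\<close> runs over \<open>1..q\<close>, the class of 0 is
      represented by \<open>q\<close>.\<close>
    define s0 where "s0 = (if x = 0 then q else nat x)"
    have x: "0 \<le> x" "x < int q"
      using assms(2) by (auto simp: x_def)
    then have s0: "s0 \<in> {1..q}"
      unfolding s0_def using assms(2) by auto
    have "[a = int s] (mod int q) \<longleftrightarrow> s = s0" if "s \<in> {1..q}" for s
      unfolding cong_def x_def[symmetric] s0_def using that x by (cases "s = q") auto
    then have "(\<Sum>s=1..q. of_bool ([a = int s] (mod int q) \<and> [b = int s] (mod int q)))
      = (\<Sum>s=1..q. if s = s0 then of_bool ([b = int s] (mod int q)) else (0::real))"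
      by (intro sum.cong) auto
    also have "\<dots> = of_bool ([b = int s0] (mod int q))"
      using s0 by simp
    also have "[a = int s0] (mod int q)"
      using assms(2) by (auto simp: s0_def x_def cong_def)
    then have "[b = int s0] (mod int q) \<longleftrightarrow> [a = b] (mod int q)"
      by (metis cong_sym cong_trans)
    finally show ?thesis .
  qed
  have "(\<Sum>s=1..q. S s) = (\<Sum>i\<in>I. \<Sum>s=1..q. of_bool ([c i = int s] (mod int q)))"
    unfolding S by (rule sum.swap)
  also have "\<dots> = (\<Sum>i\<in>I. 1)"
    by (intro sum.cong refl) (use ex1[of "c i" "c i" for i] in simp)
  finally have S1: "(\<Sum>s=1..q. S s) = real (card I)"
    by simp
  have "(\<Sum>s=1..q. (S s)\<^sup>2) = (\<Sum>s=1..q. \<Sum>i\<in>I. \<Sum>j\<in>I. of_bool ([c i = int s] (mod int q) \<and> [c j = int s] (mod int q)))"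
    unfolding S power2_eq_square sum_product by (intro sum.cong refl) (auto simp: of_bool_def)
  also have "\<dots> = (\<Sum>i\<in>I. \<Sum>j\<in>I. \<Sum>s=1..q. of_bool ([c i = int s] (mod int q) \<and> [c j = int s] (mod int q)))"
    by (subst sum.swap, intro sum.cong refl, subst sum.swap) simp
  finally have S2: "(\<Sum>s=1..q. (S s)\<^sup>2) = (\<Sum>i\<in>I. \<Sum>j\<in>I. of_bool ([c i = c j] (mod int q)))"
    unfolding ex1 .
  \<comment> \<open>Summing over \<open>h\<close> first, orthogonality leaves \<open>q\<close> times
    the number of congruent pairs, which is \<open>q\<close> times the second moment in
    \<open>S2\<close>.\<close>
  have "of_real (\<Sum>h<q. (norm (T h))\<^sup>2) = (\<Sum>h<q. T h * cnj (T h))"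
    by (simp only: of_real_sum complex_norm_square)
  also have "\<dots> = (\<Sum>h<q. \<Sum>i\<in>I. \<Sum>j\<in>I. unit_exp (real h * (of_int (c i - c j) / real q)))"
  proof (intro sum.cong refl)
    fix h
    have "T h * cnj (T h) = (\<Sum>i\<in>I. \<Sum>j\<in>I. unit_exp (real h * (of_int (c i) / real q)) * cnj (unit_exp (real h * (of_int (c j) / real q))))"
      unfolding T_def cnj_sum sum_product ..
    also have "\<dots> = (\<Sum>i\<in>I. \<Sum>j\<in>I. unit_exp (real h * (of_int (c i - c j) / real q)))"
      by (simp flip: unit_exp_uminus unit_exp_add add: algebra_simps diff_divide_distrib)
    finally show "T h * cnj (T h) = \<dots>" .
  qed
  also have "\<dots> = (\<Sum>i\<in>I. \<Sum>j\<in>I. \<Sum>h<q. unit_exp (real h * (of_int (c i - c j) / real q)))"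
    by (subst sum.swap, intro sum.cong refl, subst sum.swap) simp
  also have "\<dots> = (\<Sum>i\<in>I. \<Sum>j\<in>I. of_real (real q * of_bool ([c i = c j] (mod int q))))"
    unfolding sum_unit_exp_residues[OF assms(2)]
    by (intro sum.cong refl) (simp add: cong_iff_dvd_diff)
  also have "\<dots> = of_real (real q * (\<Sum>s=1..q. (S s)\<^sup>2))"
    unfolding S2 by (simp add: sum_distrib_left)
  finally have "(\<Sum>h<q. (norm (T h))\<^sup>2) = real q * (\<Sum>s=1..q. (S s)\<^sup>2)"
    by (simp only: of_real_eq_iff)
  moreover have "(\<Sum>h<q. (norm (T h))\<^sup>2) = (real (card I))\<^sup>2 + (\<Sum>h=1..<q. (norm (T h))\<^sup>2)"
  proof -
    have "{..<q} = insert 0 {1..<q}"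
      using assms(2) by auto
    then show ?thesis
      by (simp add: T_def)
  qed
  ultimately have P: "(\<Sum>s=1..q. (S s)\<^sup>2) = ((real (card I))\<^sup>2 + (\<Sum>h=1..<q. (norm (T h))\<^sup>2)) / real q"
    using assms(2) by (simp add: field_simps)
  have "(\<Sum>s=1..q. (S s - real (card I) / real q)\<^sup>2)
    = (\<Sum>s=1..q. (S s)\<^sup>2) - 2 * (real (card I) / real q) * (\<Sum>s=1..q. S s) + real q * (real (card I) / real q)\<^sup>2"
    by (simp add: power2_diff sum.distrib sum_subtractf sum_distrib_left sum_divide_distrib mult_ac)
  also have "\<dots> = (\<Sum>h=1..<q. (norm (T h))\<^sup>2) / real q"
    unfolding P S1 using assms(2) by (simp add: field_simps power2_eq_square)
  finally show ?thesis
    unfolding S_def T_def .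
qed

section \<open>Fibre counting and sums over \<open>a\<close> near a rational point\<close>

lemma sum_le_card_fibre_times_sum:
  fixes h :: "'a \<Rightarrow> real" and G :: "'b \<Rightarrow> real"
  assumes "finite S" and "\<And>x. x \<in> S \<Longrightarrow> h x \<le> G (g x)" and "\<And>x. x \<in> S \<Longrightarrow> 0 \<le> G (g x)"
    and "\<And>x. x \<in> S \<Longrightarrow> real (card {y \<in> S. g y = g x}) \<le> D"
  shows "sum h S \<le> D * sum G (g ` S)"
proof -
  have "sum h S = (\<Sum>y\<in>g ` S. sum h {x \<in> S. g x = y})"
    by (rule sum.image_gen[OF assms(1)])
  also have "\<dots> \<le> (\<Sum>y\<in>g ` S. D * G y)"
  proof (rule sum_mono)
    fix y assume "y \<in> g ` S"
    then obtain x where x: "x \<in> S" "y = g x" by blast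
    have "sum h {x \<in> S. g x = y} \<le> (\<Sum>z\<in>{x \<in> S. g x = y}. G y)"
      using assms(2) by (intro sum_mono) auto
    also have "\<dots> = real (card {x \<in> S. g x = y}) * G y"
      by simp
    also have "\<dots> \<le> D * G y"
      using assms(3,4) x by (intro mult_right_mono) auto
    finally show "sum h {x \<in> S. g x = y} \<le> D * G y" .
  qed
  also have "\<dots> = D * sum G (g ` S)"
    by (simp add: sum_distrib_left)
  finally show ?thesis .
qed

text \<open>Members of one class modulo \<open>v\<close> are told apart by their quotients by
  \<open>v\<close>, which lie in \<open>0..m div v\<close>.\<close>

lemma card_residue_class_le:
  fixes A :: "nat set"
  assumes "A \<subseteq> {1..m}" "v > 0" "\<And>a b. a \<in> A \<Longrightarrow> b \<in> A \<Longrightarrow> [a = b] (mod v)"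
  shows "card A \<le> m div v + 1"
proof -
  have "inj_on (\<lambda>a. a div v) A"
    by (rule inj_onI) (metis assms(3) cong_def div_mult_mod_eq)
  moreover have "(\<lambda>a. a div v) ` A \<subseteq> {..m div v}"
    using assms(1) by (force intro: div_le_mono)
  ultimately have "card A \<le> card {..m div v}"
    by (intro card_inj_on_le) auto
  then show ?thesis by simp
qed

text \<open>For \<open>a = v * i\<close> the point \<open>a * \<theta>\<close> has distance exactly
  \<open>i * y\<close> from the integers, where \<open>y\<close> is the error of the approximation.
  The first bound is trivial and serves exact approximations; the second is multiplied out by
  \<open>y\<close> to avoid dividing by 0.\<close>

lemma sum_norm_unit_exp_multiples_bounds:
  fixes \<theta> :: real and m n v :: nat and u :: int
  assumes "m > 0" "v > 0" and app: "\<bar>real v * \<theta> - of_int u\<bar> < 1 / (2 * real m)"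
  defines "F \<equiv> \<Sum>a\<in>{a \<in> {1..m}. v dvd a}. norm (\<Sum>b=1..n. unit_exp (real b * (real a * \<theta>)))"
  shows "F \<le> real n * real m / real v"
    and "F\<^sup>2 * \<bar>real v * \<theta> - of_int u\<bar> \<le> 4 * real n * real m / real v"
proof -
  define f where "f a = norm (\<Sum>b=1..n. unit_exp (real b * (real a * \<theta>)))" for a
  define y where "y = \<bar>real v * \<theta> - of_int u\<bar>"
  define M where "M = m div v"
  have M: "real M \<le> real m / real v"
    unfolding M_def by (rule of_nat_div_le_of_nat)
  have set: "{a \<in> {1..m}. v dvd a} = (\<lambda>i. v * i) ` {1..M}"
  proof (intro equalityI subsetI)
    fix a assume "a \<in> {a \<in> {1..m}. v dvd a}"
    then obtain i where "a = v * i" "1 \<le> v * i" "v * i \<le> m" by auto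
    moreover from this have "i \<le> M"
      unfolding M_def using assms(2) by (metis div_le_mono nonzero_mult_div_cancel_left not_gr_zero)
    moreover have "1 \<le> i"
      using \<open>1 \<le> v * i\<close> by (cases i) auto
    ultimately show "a \<in> (\<lambda>i. v * i) ` {1..M}"
      by (metis atLeastAtMost_iff imageI)
  next
    fix a assume "a \<in> (\<lambda>i. v * i) ` {1..M}"
    then obtain i where "a = v * i" "i \<in> {1..M}"
      by (rule imageE)
    then have i: "a = v * i" "1 \<le> i" "i \<le> M"
      by auto
    have "v * i \<le> v * M" using i by simp
    also have "\<dots> \<le> m" by (simp add: M_def)
    finally show "a \<in> {a \<in> {1..m}. v dvd a}"
      using i assms(2) by auto
  qed
  have F: "F = (\<Sum>i=1..M. f (v * i))"
    unfolding F_def set f_def using assms(2) by (subst sum.reindex) (auto simp: inj_on_def)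
  have "f a \<le> real n" for a
    unfolding f_def by (rule norm_sum_unit_exp_le)
  then have "F \<le> (\<Sum>i=1..M. real n)"
    unfolding F by (intro sum_mono)
  also have "\<dots> \<le> real n * (real m / real v)"
    using mult_left_mono[OF M, of "real n"] by (simp add: mult.commute)
  finally show "F \<le> real n * real m / real v"
    by simp
  have "f (v * i) * sqrt y \<le> sqrt (real n) * (1 / sqrt (real i))" if "i \<in> {1..M}" for i
  proof -
    have "i \<le> m"
      using that unfolding M_def by (meson atLeastAtMost_iff div_le_dividend le_trans)
    have d: "\<bar>real (v * i) * \<theta> - of_int (int i * u)\<bar> = real i * y"
    proof -
      have "real (v * i) * \<theta> - of_int (int i * u) = real i * (real v * \<theta> - of_int u)"
        by (simp add: algebra_simps)
      then show ?thesis
        by (simp add: y_def abs_mult)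
    qed
    have "real i * y \<le> real m * y"
      using \<open>i \<le> m\<close> by (intro mult_right_mono) (auto simp: y_def)
    also have "\<dots> < 1 / 2"
      using app assms(1) by (simp add: y_def field_simps)
    finally have "int_dist (real (v * i) * \<theta>) = real i * y"
      using int_dist_eqI[of "real (v * i) * \<theta>" "int i * u"] d by simp
    then have "f (v * i) * (real i * y) \<le> 1"
      unfolding f_def using norm_sum_unit_exp_mult_int_dist_le[of "real (v * i) * \<theta>" n] by simp
    \<comment> \<open>Multiplying the trivial bound \<open>n\<close> by the geometric bound
      \<open>1 / (i * y)\<close> and taking the root gives decay like \<open>1 / sqrt i\<close>,
      whose sum carries no logarithm.\<close>
    then have "f (v * i) * (f (v * i) * (real i * y)) \<le> real n * 1"
      using \<open>f (v * i) \<le> real n\<close> by (intro mult_mono) (auto simp: f_def y_def)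
    then have "(f (v * i))\<^sup>2 * y \<le> real n / real i"
      using that by (simp add: field_simps power2_eq_square)
    then have "sqrt ((f (v * i))\<^sup>2 * y) \<le> sqrt (real n / real i)"
      by simp
    then show ?thesis
      by (simp add: real_sqrt_mult real_sqrt_divide f_def)
  qed
  then have "F * sqrt y \<le> (\<Sum>i=1..M. sqrt (real n) * (1 / sqrt (real i)))"
    unfolding F sum_distrib_right by (intro sum_mono)
  also have "\<dots> \<le> sqrt (real n) * (2 * sqrt (real M))"
    unfolding sum_distrib_left[symmetric] by (intro mult_left_mono sum_inverse_sqrt_le) auto
  finally have "(F * sqrt y)\<^sup>2 \<le> (sqrt (real n) * (2 * sqrt (real M)))\<^sup>2"
    by (intro power_mono) (auto simp: F f_def y_def intro!: mult_nonneg_nonneg sum_nonneg)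
  then have "F\<^sup>2 * y \<le> 4 * real n * real M"
    by (simp add: power_mult_distrib y_def)
  also have "\<dots> \<le> 4 * real n * (real m / real v)"
    using M by (intro mult_left_mono) auto
  finally show "F\<^sup>2 * \<bar>real v * \<theta> - of_int u\<bar> \<le> 4 * real n * real m / real v"
    by (simp add: y_def)
qed

text \<open>Here \<open>a * \<theta>\<close> is close to \<open>a * u / v\<close>, which is not an
  integer, so the geometric bound gives about \<open>v / \<bar>r\<bar>\<close> for a nonzero residue
  \<open>r\<close> of \<open>a * u\<close>. Each \<open>r\<close> occurs at most
  \<open>m / v + 1\<close> times, which leaves a harmonic sum.\<close>

lemma sum_norm_unit_exp_nonmultiples_bound:
  fixes \<theta> :: real and m n v :: nat and u :: int
  assumes "m > 0" "v > 0" "v \<le> 2 * m" "coprime u (int v)"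
    and app: "\<bar>real v * \<theta> - of_int u\<bar> < 1 / (2 * real m)"
  shows "(\<Sum>a\<in>{a \<in> {1..m}. \<not> v dvd a}. norm (\<Sum>b=1..n. unit_exp (real b * (real a * \<theta>))))
    \<le> 12 * real m * harm (2 * m)"
proof -
  define S where "S = {a \<in> {1..m}. \<not> v dvd a}"
  define f where "f a = norm (\<Sum>b=1..n. unit_exp (real b * (real a * \<theta>)))" for a
  \<comment> \<open>The residue of \<open>a * u\<close> modulo \<open>v\<close> is normalised by the
    integer nearest to \<open>a * \<theta>\<close>, so that \<open>r a / v\<close> approximates the
    signed distance to that integer.\<close>
  define r where "r a = int a * u - round (real a * \<theta>) * int v" for a
  have r0: "r a \<noteq> 0" if "a \<in> S" for a
  proof
    assume "r a = 0"
    then have "int v dvd int a * u"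
      by (simp add: r_def)
    then have "int v dvd int a"
      using assms(4) by (simp add: coprime_commute coprime_dvd_mult_left_iff)
    with that show False by (simp add: S_def)
  qed
  have near: "\<bar>real_of_int (r a) - real v * (real a * \<theta> - of_int (round (real a * \<theta>)))\<bar> \<le> 1 / 2"
    if "a \<in> S" for a
  proof -
    have "\<bar>real_of_int (r a) - real v * (real a * \<theta> - of_int (round (real a * \<theta>)))\<bar>
        = real a * \<bar>real v * \<theta> - of_int u\<bar>"
    proof -
      have "real_of_int (r a) - real v * (real a * \<theta> - of_int (round (real a * \<theta>)))
          = - (real a * (real v * \<theta> - of_int u))"
        by (simp add: r_def algebra_simps)
      then show ?thesis
        by (simp add: abs_mult)
    qed
    also have "\<dots> \<le> real m * (1 / (2 * real m))"
      using that app by (intro mult_mono) (auto simp: S_def)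
    finally show ?thesis using assms(1) by simp
  qed
  have r_le: "\<bar>r a\<bar> \<le> int v" if "a \<in> S" for a
  proof -
    have "\<bar>real v * (real a * \<theta> - of_int (round (real a * \<theta>)))\<bar> \<le> real v * (1 / 2)"
      using int_dist_le_half[of "real a * \<theta>"] unfolding abs_mult int_dist_def
      by (intro mult_mono) auto
    with near[OF that] have "\<bar>real_of_int (r a)\<bar> \<le> real v / 2 + 1 / 2" by linarith
    also have "\<dots> \<le> real v" using assms(2) by simp
    finally show ?thesis by linarith
  qed
  \<comment> \<open>Since \<open>\<bar>r a\<bar> \<ge> 1\<close>, the error \<open>1 / 2\<close>
    from \<open>near\<close> costs at most a factor 2.\<close>
  have f_le: "f a \<le> 2 * real v * (1 / \<bar>real_of_int (r a)\<bar>)" if "a \<in> S" for a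
  proof -
    have "1 \<le> \<bar>real_of_int (r a)\<bar>"
      using r0[OF that] by linarith
    moreover have "real v * int_dist (real a * \<theta>)
        = \<bar>real v * (real a * \<theta> - of_int (round (real a * \<theta>)))\<bar>"
      by (simp add: int_dist_def abs_mult)
    ultimately have "\<bar>real_of_int (r a)\<bar> \<le> 2 * (real v * int_dist (real a * \<theta>))"
      using near[OF that] by linarith
    then have "f a * \<bar>real_of_int (r a)\<bar> \<le> f a * (2 * (real v * int_dist (real a * \<theta>)))"
      by (intro mult_left_mono) (auto simp: f_def)
    also have "\<dots> = 2 * real v * (f a * int_dist (real a * \<theta>))"
      by simp
    also have "\<dots> \<le> 2 * real v * 1"
      unfolding f_def by (intro mult_left_mono norm_sum_unit_exp_mult_int_dist_le) auto
    finally show ?thesis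
      using r0[OF that] by (simp add: field_simps)
  qed
  have fibre: "real (card {b \<in> S. r b = r a}) \<le> real m / real v + 1" if "a \<in> S" for a
  proof -
    have "card {b \<in> S. r b = r a} \<le> m div v + 1"
    proof (rule card_residue_class_le)
      fix b c assume "b \<in> {b \<in> S. r b = r a}" "c \<in> {b \<in> S. r b = r a}"
      then have "r b = r c" by simp
      then have "int b * u - int c * u = (round (real b * \<theta>) - round (real c * \<theta>)) * int v"
        by (simp add: r_def algebra_simps)
      then have "[int b * u = int c * u] (mod int v)"
        by (simp add: cong_iff_dvd_diff)
      then have "[int b = int c] (mod int v)"
        using assms(4) by (simp add: cong_mult_rcancel)
      then show "[b = c] (mod v)"
        by (simp add: cong_int_iff)
    qed (use assms(2) in \<open>auto simp: S_def\<close>)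
    then have "real (card {b \<in> S. r b = r a}) \<le> real (m div v) + 1"
      by linarith
    also have "\<dots> \<le> real m / real v + 1"
      using of_nat_div_le_of_nat[of m v] by simp
    finally show ?thesis .
  qed
  have "sum f S \<le> (real m / real v + 1) * (\<Sum>x\<in>r ` S. 2 * real v * (1 / \<bar>real_of_int x\<bar>))"
    by (rule sum_le_card_fibre_times_sum) (use f_le fibre in \<open>auto simp: S_def\<close>)
  also have "\<dots> = 2 * (real m + real v) * (\<Sum>x\<in>r ` S. 1 / \<bar>real_of_int x\<bar>)"
    unfolding sum_distrib_left[symmetric] using assms(2) by (simp add: field_simps)
  also have "\<dots> \<le> 2 * (real m + real v) * (2 * harm v)"
    using r0 r_le by (intro mult_left_mono sum_inverse_abs_le_harm) auto
  also have "\<dots> \<le> 2 * (3 * real m) * (2 * harm (2 * m))"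
    using assms(3) by (intro mult_mono harm_mono) (auto simp: harm_nonneg)
  finally show ?thesis
    by (simp add: S_def f_def)
qed

section \<open>Summation over the frequencies\<close>

lemma sum_cartesian_product_mult:
  fixes c :: "'c :: comm_semiring_0"
  shows "(\<Sum>(a, b)\<in>A \<times> B. c * (f a * g b)) = c * (sum f A * sum g B)"
  by (subst sum_product) (simp add: sum.cartesian_product sum_distrib_left case_prod_unfold)

lemma card_int_divisors_le:
  fixes l :: int
  assumes "l \<noteq> 0"
  shows "card {d. d dvd l} \<le> 2 * card {d. d dvd nat \<bar>l\<bar>}"
proof -
  have "{d. d dvd l} \<subseteq> int ` {d. d dvd nat \<bar>l\<bar>} \<union> (\<lambda>d. - int d) ` {d. d dvd nat \<bar>l\<bar>}"
  proof
    fix d assume "d \<in> {d. d dvd l}"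
    then have "nat \<bar>d\<bar> dvd nat \<bar>l\<bar>"
      by (simp add: nat_abs_dvd_iff)
    moreover have "d = int (nat \<bar>d\<bar>) \<or> d = - int (nat \<bar>d\<bar>)"
      by linarith
    ultimately show "d \<in> int ` {d. d dvd nat \<bar>l\<bar>} \<union> (\<lambda>d. - int d) ` {d. d dvd nat \<bar>l\<bar>}"
      by blast
  qed
  moreover have fin: "finite {d. d dvd nat \<bar>l\<bar>}"
    using assms by (intro finite_divisors_nat) auto
  ultimately have "card {d. d dvd l}
      \<le> card (int ` {d. d dvd nat \<bar>l\<bar>} \<union> (\<lambda>d. - int d) ` {d. d dvd nat \<bar>l\<bar>})"
    by (intro card_mono) auto
  also have "\<dots> \<le> card (int ` {d. d dvd nat \<bar>l\<bar>}) + card ((\<lambda>d. - int d) ` {d. d dvd nat \<bar>l\<bar>})"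
    by (rule card_Un_le)
  also have "\<dots> \<le> card {d. d dvd nat \<bar>l\<bar>} + card {d. d dvd nat \<bar>l\<bar>}"
    using fin by (intro add_mono card_image_le)
  finally show ?thesis by simp
qed

text \<open>
  In the application the index \<open>h\<close> is a frequency modulo \<open>q\<close>, \<open>j h\<close> is the centred residue of
  \<open>\<rho> * h\<close>, \<open>B h\<close> is the size of the exponential sum over \<open>r\<close>, and \<open>v h\<close>, \<open>x h\<close> come from the
  Dirichlet approximation \<open>h / q = u / v h + x h / (q * v h)\<close>.
\<close>

locale frequency_data =
  fixes H :: "'a set" and q k m :: nat and \<rho> :: int
    and j v x :: "'a \<Rightarrow> int" and B :: "'a \<Rightarrow> real"
  assumes finite_H: "finite H" and q_pos: "q > 0"
    and inj_j: "inj_on j H"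
    and j_nonzero: "h \<in> H \<Longrightarrow> j h \<noteq> 0" and j_le: "h \<in> H \<Longrightarrow> \<bar>j h\<bar> \<le> int q"
    and v_pos: "h \<in> H \<Longrightarrow> v h > 0" and v_le: "h \<in> H \<Longrightarrow> v h \<le> int (2 * m)"
    and x_le: "h \<in> H \<Longrightarrow> \<bar>x h\<bar> \<le> int q"
    and cong_jv: "h \<in> H \<Longrightarrow> [j h * v h = \<rho> * x h] (mod int q)"
    and B_nonneg: "h \<in> H \<Longrightarrow> B h \<ge> 0" and B_le: "h \<in> H \<Longrightarrow> B h \<le> real k"
    and B_mult_j_le: "h \<in> H \<Longrightarrow> B h * \<bar>real_of_int (j h)\<bar> \<le> real q"
begin

lemma B_square_mult_j_le: "h \<in> H \<Longrightarrow> (B h)\<^sup>2 * \<bar>real_of_int (j h)\<bar> \<le> real k * real q"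
  using mult_mono[OF B_le B_mult_j_le, of h h] B_nonneg by (simp add: power2_eq_square mult_ac)

text \<open>The residues \<open>j h\<close> are distinct and nonzero, so the pointwise bound
  \<open>k * q / \<bar>j h\<bar>\<close> sums to a harmonic sum.\<close>

lemma sum_B_square_le: "(\<Sum>h\<in>H. (B h)\<^sup>2) \<le> 2 * real k * real q * harm q"
proof -
  have "(\<Sum>h\<in>H. (B h)\<^sup>2) \<le> (\<Sum>h\<in>H. real k * real q * (1 / \<bar>real_of_int (j h)\<bar>))"
    using B_square_mult_j_le j_nonzero by (intro sum_mono) (simp add: field_simps)
  also have "\<dots> = real k * real q * (\<Sum>y\<in>j ` H. 1 / \<bar>real_of_int y\<bar>)"
    by (simp add: sum.reindex[OF inj_j] sum_distrib_left)
  also have "\<dots> \<le> real k * real q * (2 * harm q)"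
    using j_nonzero j_le by (intro mult_left_mono sum_inverse_abs_le_harm) auto
  finally show ?thesis by simp
qed

text \<open>If \<open>x h = 0\<close> then \<open>j h * v h = q * l\<close> with
  \<open>0 < \<bar>l\<bar> \<le> 2 * m\<close>. The pair \<open>(v h, l)\<close> determines
  \<open>j h\<close> and hence \<open>h\<close>, and the summand is at most
  \<open>k / (v h * \<bar>l\<bar>)\<close>, so the sum is dominated by a product of two harmonic
  sums.\<close>

lemma sum_exact_frequencies_le:
  "(\<Sum>h\<in>{h \<in> H. x h = 0}. (B h)\<^sup>2 / (real_of_int (v h))\<^sup>2) \<le> 4 * real k * (harm (2 * m))\<^sup>2"
proof -
  define S where "S = {h \<in> H. x h = 0}"
  define l where "l h = j h * v h div int q" for h
  have l: "j h * v h = int q * l h" if "h \<in> S" for h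
    using cong_jv[of h] that by (simp add: S_def l_def cong_0_iff)
  have l0: "l h \<noteq> 0" if "h \<in> S" for h
    using l[OF that] j_nonzero[of h] v_pos[of h] that by (auto simp: S_def)
  have l_le: "\<bar>l h\<bar> \<le> int (2 * m)" if "h \<in> S" for h
  proof -
    have "int q * \<bar>l h\<bar> = \<bar>j h\<bar> * v h"
      using l[OF that] v_pos[of h] that by (metis (no_types, lifting) S_def abs_mult abs_of_nat abs_of_pos mem_Collect_eq)
    also have "\<dots> \<le> int q * int (2 * m)"
      using that j_le v_le v_pos[of h] by (intro mult_mono) (auto simp: S_def)
    finally show ?thesis
      using q_pos by simp
  qed
  define G where "G = (\<lambda>(a::int, b::int). real k * ((1 / \<bar>real_of_int a\<bar>) * (1 / \<bar>real_of_int b\<bar>)))"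
  have "(\<Sum>h\<in>S. (B h)\<^sup>2 / (real_of_int (v h))\<^sup>2) \<le> 1 * sum G ((\<lambda>h. (v h, l h)) ` S)"
  proof (rule sum_le_card_fibre_times_sum)
    fix h assume h: "h \<in> S"
    then have h': "h \<in> H" by (simp add: S_def)
    have vp: "real_of_int (v h) > 0" using v_pos[OF h'] by simp
    have "real_of_int (j h) * real_of_int (v h) = real q * real_of_int (l h)"
      using l[OF h] by (metis of_int_mult of_int_of_nat_eq)
    then have e: "\<bar>real_of_int (j h)\<bar> * real_of_int (v h) = real q * \<bar>real_of_int (l h)\<bar>"
      using vp by (metis abs_mult abs_of_nat abs_of_pos)
    have "(B h)\<^sup>2 * \<bar>real_of_int (l h)\<bar> * real q = (B h)\<^sup>2 * \<bar>real_of_int (j h)\<bar> * real_of_int (v h)"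
      using e by (simp add: mult_ac)
    also have "\<dots> \<le> real k * real q * real_of_int (v h)"
      using B_square_mult_j_le[OF h'] vp by (intro mult_right_mono) auto
    finally have "(B h)\<^sup>2 * \<bar>real_of_int (l h)\<bar> \<le> real k * real_of_int (v h)"
      using q_pos by (simp add: mult_ac)
    then show "(B h)\<^sup>2 / (real_of_int (v h))\<^sup>2 \<le> G (v h, l h)"
      using vp l0[OF h] by (simp add: G_def field_simps power2_eq_square)
    have "{y \<in> S. (v y, l y) = (v h, l h)} = {h}"
    proof (intro equalityI subsetI)
      fix y assume "y \<in> {y \<in> S. (v y, l y) = (v h, l h)}"
      then have y: "y \<in> S" "v y = v h" "l y = l h" by auto
      then have "j y * v h = j h * v h"
        using l[OF h] l[OF y(1)] by simp
      then have "j y = j h"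
        using v_pos[OF h'] by simp
      then show "y \<in> {h}"
        using inj_j y(1) h' by (auto simp: S_def inj_on_def)
    qed (use h in auto)
    then show "real (card {y \<in> S. (v y, l y) = (v h, l h)}) \<le> 1" by simp
  qed (use finite_H in \<open>auto simp: S_def G_def\<close>)
  also have "\<dots> \<le> 1 * sum G ({1..int (2 * m)} \<times> {y. y \<noteq> 0 \<and> \<bar>y\<bar> \<le> int (2 * m)})"
  proof (intro mult_left_mono sum_mono2)
    show "finite ({1..int (2 * m)} \<times> {y. y \<noteq> 0 \<and> \<bar>y\<bar> \<le> int (2 * m)})"
      by (intro finite_cartesian_product finite_subset[of "{y. y \<noteq> 0 \<and> \<bar>y\<bar> \<le> int (2 * m)}" "{- int (2 * m)..int (2 * m)}"]) auto
    show "(\<lambda>h. (v h, l h)) ` S \<subseteq> {1..int (2 * m)} \<times> {y. y \<noteq> 0 \<and> \<bar>y\<bar> \<le> int (2 * m)}"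
    proof (rule image_subsetI)
      fix h assume h: "h \<in> S"
      then have "1 \<le> v h" "v h \<le> int (2 * m)"
        using v_pos[of h] v_le[of h] by (auto simp: S_def)
      with l0[OF h] l_le[OF h] show "(v h, l h) \<in> {1..int (2 * m)} \<times> {y. y \<noteq> 0 \<and> \<bar>y\<bar> \<le> int (2 * m)}"
        by simp
    qed
  qed (auto simp: G_def)
  also have "\<dots> = 1 * (real k * ((\<Sum>a\<in>{1..int (2 * m)}. 1 / \<bar>real_of_int a\<bar>)
      * (\<Sum>b\<in>{y. y \<noteq> 0 \<and> \<bar>y\<bar> \<le> int (2 * m)}. 1 / \<bar>real_of_int b\<bar>)))"
    unfolding G_def sum_cartesian_product_mult ..
  also have "\<dots> \<le> 1 * (real k * ((2 * harm (2 * m)) * (2 * harm (2 * m))))"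
    by (intro mult_left_mono mult_mono sum_inverse_abs_le_harm) (auto simp: harm_nonneg intro!: sum_nonneg)
  finally show ?thesis
    by (simp add: S_def power2_eq_square)
qed

text \<open>The product \<open>l = j h * v h\<close> is determined by \<open>x h\<close> and its
  quotient \<open>i\<close> by \<open>q\<close>. As \<open>j h\<close> divides \<open>l\<close>, at
  most \<open>2 * D\<close> frequencies share a pair \<open>(x h, i)\<close>. The summand is at most
  \<open>4 * k\<^sup>2 / (\<bar>x h\<bar> * (\<bar>i\<bar> + 1))\<close>, which again
  factorises.\<close>

lemma sum_inexact_frequencies_le:
  assumes "m > 0"
    and D: "\<And>l. 0 < l \<Longrightarrow> l \<le> 2 * m * q \<Longrightarrow> real (card {d. d dvd l}) \<le> D"
  shows "(\<Sum>h\<in>{h \<in> H. x h \<noteq> 0}. (B h)\<^sup>2 / (real_of_int (v h) * \<bar>real_of_int (x h)\<bar>))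
    \<le> 48 * D * (real k)\<^sup>2 * harm q * harm (2 * m + 1)"
proof -
  define S where "S = {h \<in> H. x h \<noteq> 0}"
  define l where "l h = j h * v h" for h
  define i where "i h = l h div int q" for h
  have SH: "h \<in> H" if "h \<in> S" for h using that by (simp add: S_def)
  have l0: "l h \<noteq> 0" if "h \<in> S" for h
    using j_nonzero[of h] v_pos[of h] that by (auto simp: S_def l_def)
  have l_abs: "\<bar>l h\<bar> = \<bar>j h\<bar> * v h" if "h \<in> S" for h
    using v_pos[OF SH[OF that]] by (simp add: l_def abs_mult)
  have l_le: "\<bar>l h\<bar> \<le> int q * int (2 * m)" if "h \<in> S" for h
    unfolding l_abs[OF that] using SH[OF that] j_le v_le v_pos[of h] by (intro mult_mono) auto
  have l_mod: "l h = int q * i h + \<rho> * x h mod int q" if "h \<in> S" for h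
  proof -
    have "l h mod int q = \<rho> * x h mod int q"
      using cong_jv[OF SH[OF that]] by (simp add: l_def cong_def)
    then show ?thesis
      unfolding i_def by (metis mult_div_mod_eq)
  qed
  have i_bounds: "int q * i h \<le> l h" "l h < int q * i h + int q" if "h \<in> S" for h
    using l_mod[OF that] q_pos pos_mod_bound[of "int q" "\<rho> * x h"] pos_mod_sign[of "int q" "\<rho> * x h"] by linarith+
  have i_le: "\<bar>i h\<bar> \<le> int (2 * m + 1)" if "h \<in> S" for h
  proof -
    have "int q * i h \<le> int q * int (2 * m)"
      using i_bounds[OF that] l_le[OF that] by linarith
    then have "i h \<le> int (2 * m)" using q_pos by simp
    moreover have "int q * (- int (2 * m)) \<le> int q * (i h + 1)"
      unfolding distrib_left mult_minus_right using i_bounds[OF that] l_le[OF that] by linarith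
    then have "- int (2 * m) \<le> i h + 1" using q_pos by (simp only: mult_le_cancel_left_pos of_nat_0_less_iff)
    ultimately show ?thesis by simp
  qed
  \<comment> \<open>The shift by 1 allows the quotient 0. For negative quotients rounding down costs
    one more \<open>q\<close>, which the factor 2 absorbs.\<close>
  have ql: "int q * (\<bar>i h\<bar> + 1) \<le> 2 * (int q + \<bar>l h\<bar>)" if "h \<in> S" for h
  proof (cases "i h \<ge> 0")
    case True
    then have "int q * \<bar>i h\<bar> \<le> \<bar>l h\<bar>"
      using i_bounds[OF that] by simp
    then show ?thesis
      by (simp add: algebra_simps)
  next
    case False
    then have "int q * \<bar>i h\<bar> \<le> int q + \<bar>l h\<bar>"
      using i_bounds[OF that] by (simp add: algebra_simps)
    moreover have "int q \<le> int q * \<bar>i h\<bar>"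
      using False mult_left_mono[of 1 "\<bar>i h\<bar>" "int q"] by simp
    ultimately show ?thesis
      by (simp add: algebra_simps)
  qed
  define G where "G = (\<lambda>(a::int, b::int). 4 * (real k)\<^sup>2 * ((1 / \<bar>real_of_int a\<bar>) * (1 / (\<bar>real_of_int b\<bar> + 1))))"
  have "D \<ge> 0"
    using D[of 1] assms(1) q_pos of_nat_0_le_iff order_trans by fastforce
  have "(\<Sum>h\<in>S. (B h)\<^sup>2 / (real_of_int (v h) * \<bar>real_of_int (x h)\<bar>)) \<le> (2 * D) * sum G ((\<lambda>h. (x h, i h)) ` S)"
  proof (rule sum_le_card_fibre_times_sum)
    fix h assume h: "h \<in> S"
    note h' = SH[OF h]
    have v1: "real_of_int (v h) \<ge> 1" using v_pos[OF h'] by simp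
    have xp: "\<bar>real_of_int (x h)\<bar> > 0" using h by (simp add: S_def)
    \<comment> \<open>Two bounds for \<open>B h\<close> are combined: \<open>B h \<le> k\<close>
      controls \<open>Q * q\<close>, and the decay in \<open>j h\<close> controls
      \<open>Q * \<bar>l h\<bar>\<close>. By \<open>ql\<close> their sum controls
      \<open>Q * q * (\<bar>i h\<bar> + 1)\<close>.\<close>
    define Q where "Q = (B h)\<^sup>2 / real_of_int (v h)"
    have "(B h)\<^sup>2 \<le> (real k)\<^sup>2"
      using B_le[OF h'] B_nonneg[OF h'] by (intro power_mono)
    also have "\<dots> \<le> (real k)\<^sup>2 * real_of_int (v h)"
      using v1 by (simp add: mult_le_cancel_left1)
    finally have "Q \<le> (real k)\<^sup>2"
      using v1 by (simp add: Q_def field_simps)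
    then have Q1: "Q * real q \<le> (real k)\<^sup>2 * real q"
      by (intro mult_right_mono) auto
    have "\<bar>real_of_int (l h)\<bar> = \<bar>real_of_int (j h)\<bar> * real_of_int (v h)"
      using l_abs[OF h] by (metis of_int_abs of_int_mult)
    then have "Q * \<bar>real_of_int (l h)\<bar> = (B h)\<^sup>2 * \<bar>real_of_int (j h)\<bar>"
      using v1 by (simp add: Q_def)
    also have "\<dots> \<le> real k * real q"
      by (rule B_square_mult_j_le[OF h'])
    also have "\<dots> \<le> (real k)\<^sup>2 * real q"
      by (intro mult_right_mono) (cases "k = 0", auto simp: power2_eq_square)
    finally have Q2: "Q * \<bar>real_of_int (l h)\<bar> \<le> (real k)\<^sup>2 * real q" .
    have "real_of_int (int q * (\<bar>i h\<bar> + 1)) \<le> real_of_int (2 * (int q + \<bar>l h\<bar>))"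
      using ql[OF h] by (simp only: of_int_le_iff)
    then have "Q * (real q * (\<bar>real_of_int (i h)\<bar> + 1)) \<le> Q * (2 * (real q + \<bar>real_of_int (l h)\<bar>))"
      using v1 by (intro mult_left_mono) (auto simp: Q_def)
    also have "\<dots> \<le> 4 * (real k)\<^sup>2 * real q"
      using Q1 Q2 by (simp add: algebra_simps)
    finally have "Q * (\<bar>real_of_int (i h)\<bar> + 1) \<le> 4 * (real k)\<^sup>2"
      using q_pos by (simp add: mult_ac)
    then have "Q \<le> 4 * (real k)\<^sup>2 * (1 / (\<bar>real_of_int (i h)\<bar> + 1))"
      by (simp add: field_simps)
    then have "Q * (1 / \<bar>real_of_int (x h)\<bar>) \<le> 4 * (real k)\<^sup>2 * (1 / (\<bar>real_of_int (i h)\<bar> + 1)) * (1 / \<bar>real_of_int (x h)\<bar>)"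
      by (intro mult_right_mono) auto
    then show "(B h)\<^sup>2 / (real_of_int (v h) * \<bar>real_of_int (x h)\<bar>) \<le> G (x h, i h)"
      by (simp add: G_def Q_def mult_ac)
    \<comment> \<open>Equal \<open>x\<close> and \<open>i\<close> force equal \<open>l\<close> by
      \<open>l_mod\<close>, so the values of \<open>j\<close> on the fibre are distinct divisors of
      one nonzero integer.\<close>
    have "j ` {y \<in> S. (x y, i y) = (x h, i h)} \<subseteq> {d. d dvd l h}"
    proof (rule image_subsetI)
      fix y assume "y \<in> {y \<in> S. (x y, i y) = (x h, i h)}"
      then have "y \<in> S" "l y = l h"
        using l_mod[OF h] l_mod[of y] by auto
      then show "j y \<in> {d. d dvd l h}"
        by (metis dvd_triv_left l_def mem_Collect_eq)
    qed
    moreover have "inj_on j {y \<in> S. (x y, i y) = (x h, i h)}"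
      by (rule inj_on_subset[OF inj_j]) (auto simp: S_def)
    moreover have "finite {d. d dvd l h}"
      using l0[OF h] by (rule finite_divisors_int)
    ultimately have "card {y \<in> S. (x y, i y) = (x h, i h)} \<le> card {d. d dvd l h}"
      by (intro card_inj_on_le)
    also have "\<dots> \<le> 2 * card {d. d dvd nat \<bar>l h\<bar>}"
      by (rule card_int_divisors_le[OF l0[OF h]])
    finally have "real (card {y \<in> S. (x y, i y) = (x h, i h)}) \<le> 2 * real (card {d. d dvd nat \<bar>l h\<bar>})"
      by linarith
    also have "\<dots> \<le> 2 * D"
      using l0[OF h] l_le[OF h] by (intro mult_left_mono D) (auto simp: nat_le_iff mult_ac)
    finally show "real (card {y \<in> S. (x y, i y) = (x h, i h)}) \<le> 2 * D" .
  qed (use finite_H in \<open>auto simp: S_def G_def\<close>)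
  also have "\<dots> \<le> (2 * D) * sum G ({y. y \<noteq> 0 \<and> \<bar>y\<bar> \<le> int q} \<times> {- int (2 * m + 1)..int (2 * m + 1)})"
  proof (intro mult_left_mono sum_mono2)
    show "finite ({y. y \<noteq> 0 \<and> \<bar>y\<bar> \<le> int q} \<times> {- int (2 * m + 1)..int (2 * m + 1)})"
      by (intro finite_cartesian_product finite_subset[of "{y. y \<noteq> 0 \<and> \<bar>y\<bar> \<le> int q}" "{- int q..int q}"]) auto
    show "(\<lambda>h. (x h, i h)) ` S \<subseteq> {y. y \<noteq> 0 \<and> \<bar>y\<bar> \<le> int q} \<times> {- int (2 * m + 1)..int (2 * m + 1)}"
    proof (rule image_subsetI)
      fix h assume h: "h \<in> S"
      then have "x h \<noteq> 0" "\<bar>x h\<bar> \<le> int q"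
        using x_le[of h] by (auto simp: S_def)
      with i_le[OF h] show "(x h, i h) \<in> {y. y \<noteq> 0 \<and> \<bar>y\<bar> \<le> int q} \<times> {- int (2 * m + 1)..int (2 * m + 1)}"
        by auto
    qed
  qed (use \<open>D \<ge> 0\<close> in \<open>auto simp: G_def\<close>)
  also have "\<dots> = (2 * D) * (4 * (real k)\<^sup>2 * ((\<Sum>a\<in>{y. y \<noteq> 0 \<and> \<bar>y\<bar> \<le> int q}. 1 / \<bar>real_of_int a\<bar>)
      * (\<Sum>b\<in>{- int (2 * m + 1)..int (2 * m + 1)}. 1 / (\<bar>real_of_int b\<bar> + 1))))"
    unfolding G_def sum_cartesian_product_mult ..
  also have "\<dots> \<le> (2 * D) * (4 * (real k)\<^sup>2 * ((2 * harm q) * (3 * harm (2 * m + 1))))"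
  proof (intro mult_left_mono mult_mono)
    \<comment> \<open>The term \<open>b = 0\<close> is split off; it equals 1, which is at most one
      further harmonic number, hence the factor 3.\<close>
    define A where "A = {- int (2 * m + 1)..int (2 * m + 1)} - {0}"
    have "{- int (2 * m + 1)..int (2 * m + 1)} = insert 0 A" "finite A" "0 \<notin> A"
      by (auto simp: A_def)
    then have "(\<Sum>b\<in>{- int (2 * m + 1)..int (2 * m + 1)}. 1 / (\<bar>real_of_int b\<bar> + 1))
      = 1 + (\<Sum>b\<in>A. 1 / (\<bar>real_of_int b\<bar> + 1))"
      by (simp only: sum.insert) simp
    also have "(\<Sum>b\<in>A. 1 / (\<bar>real_of_int b\<bar> + 1)) \<le> (\<Sum>b\<in>A. 1 / \<bar>real_of_int b\<bar>)"
      by (intro sum_mono divide_left_mono) (auto simp: A_def)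
    also have "\<dots> \<le> 2 * harm (2 * m + 1)"
      by (rule sum_inverse_abs_le_harm) (auto simp: A_def)
    also have "(1::real) \<le> harm (2 * m + 1)"
      using harm_mono[of 1 "2 * m + 1", where 'a = real] by (simp add: harm_expand)
    finally show "(\<Sum>b\<in>{- int (2 * m + 1)..int (2 * m + 1)}. 1 / (\<bar>real_of_int b\<bar> + 1)) \<le> 3 * harm (2 * m + 1)"
      by simp
  qed (use \<open>D \<ge> 0\<close> in \<open>auto simp: harm_nonneg intro!: sum_nonneg sum_inverse_abs_le_harm\<close>)
  finally show ?thesis
    by (simp add: S_def mult_ac)
qed

end

text \<open>Dirichlet approximation of \<open>h / q\<close> with denominators up to
  \<open>2 * m\<close> splits \<open>A h\<close> into multiples and nonmultiples of the denominator.
  The nonmultiples are uniformly \<open>O(m * L)\<close> and need only the mean square of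
  \<open>B\<close>; the multiples are treated separately for exact and inexact approximations.
  \<open>L\<close> majorises all harmonic numbers that occur.\<close>

lemma sum_exponential_sums_square_le:
  fixes q k m n :: nat and \<rho> :: int and D L :: real
  assumes "q > 0" "m > 0" "coprime \<rho> (int q)"
    and D: "\<And>l. 0 < l \<Longrightarrow> l \<le> 2 * m * q \<Longrightarrow> real (card {d. d dvd l}) \<le> D"
    and L: "harm q \<le> L" "harm (2 * m + 1) \<le> L"
  defines "A \<equiv> \<lambda>h. \<Sum>a=1..m. norm (\<Sum>b=1..n. unit_exp (real b * (real a * (real h / real q))))"
    and "B \<equiv> \<lambda>h. norm (\<Sum>r=1..k. unit_exp (real r * (of_int (\<rho> * int h) / real q)))"
  shows "(\<Sum>h=1..<q. (A h * B h)\<^sup>2)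
    \<le> 8 * (real n * real m)\<^sup>2 * real k * L\<^sup>2 + 384 * D * real n * real m * real q * (real k)\<^sup>2 * L\<^sup>2
      + 576 * (real m)\<^sup>2 * real k * real q * L ^ 3"
proof -
  have "\<exists>u v. coprime u v \<and> 0 < v \<and> v \<le> int (2 * m)
      \<and> \<bar>of_int v * (real h / real q) - of_int u\<bar> < 1 / (2 * real m)" for h
    using Dirichlet_approx_coprime[of "2 * m" "real h / real q"] assms(2)
    by (metis mult_pos_pos of_nat_mult of_nat_numeral zero_less_numeral)
  then obtain u v where u_v: "\<And>h. coprime (u h) (v h)" "\<And>h. 0 < v h" "\<And>h. v h \<le> int (2 * m)"
      "\<And>h. \<bar>of_int (v h) * (real h / real q) - of_int (u h)\<bar> < 1 / (2 * real m)"
    by metis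
  \<comment> \<open>Thus \<open>h / q = u h / v h + x h / (q * v h)\<close>, and \<open>x h\<close>
    is congruent to \<open>v h * h\<close> modulo \<open>q\<close>, which yields the relation
    between \<open>j h * v h\<close> and \<open>\<rho> * x h\<close>.\<close>
  define x where "x h = v h * int h - u h * int q" for h
  define j where "j h = \<rho> * int h - int q * round (of_int (\<rho> * int h) / real q)" for h
  have x_eq: "\<bar>real_of_int (x h)\<bar> = real q * \<bar>of_int (v h) * (real h / real q) - of_int (u h)\<bar>" for h
  proof -
    have "real_of_int (x h) = real q * (of_int (v h) * (real h / real q) - of_int (u h))"
      using assms(1) by (simp add: x_def field_simps)
    then show ?thesis
      by (simp add: abs_mult)
  qed
  have j_eq: "\<bar>real_of_int (j h)\<bar> = real q * int_dist (of_int (\<rho> * int h) / real q)" for h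
  proof -
    have "real_of_int (j h) = real q * (of_int (\<rho> * int h) / real q - of_int (round (of_int (\<rho> * int h) / real q)))"
      using assms(1) by (simp add: j_def field_simps)
    then show ?thesis
      by (simp add: abs_mult int_dist_def)
  qed
  have j_cong: "[j h = \<rho> * int h] (mod int q)" for h
    by (simp add: j_def cong_iff_dvd_diff)
  have L1: "1 \<le> L"
    using harm_mono[of 1 "2 * m + 1", where 'a = real] L(2) by (simp add: harm_expand)
  interpret frequency_data "{1..<q}" q k m \<rho> j v x B
  proof
    show "inj_on j {1..<q}"
    proof (rule inj_onI)
      fix h h' assume h: "h \<in> {1..<q}" "h' \<in> {1..<q}" "j h = j h'"
      then have "[\<rho> * int h = \<rho> * int h'] (mod int q)"
        using j_cong by (metis cong_sym cong_trans)
      then have "[int h = int h'] (mod int q)"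
        using assms(3) by (simp add: cong_mult_lcancel)
      then show "h = h'"
        using h by (simp add: cong_int_iff cong_less_modulus_unique_nat)
    qed
    fix h assume h: "h \<in> {1..<q}"
    show "j h \<noteq> 0"
    proof
      assume "j h = 0"
      then have "int q dvd \<rho> * int h"
        using cong_sym[OF j_cong[of h]] by (simp add: cong_0_iff)
      then have "int q dvd int h"
        using assms(3) by (simp add: coprime_commute coprime_dvd_mult_right_iff)
      then show False
        using h by (auto dest: dvd_imp_le)
    qed
    have "\<bar>real_of_int (j h)\<bar> \<le> real q * 1"
      unfolding j_eq using int_dist_le_half[of "of_int (\<rho> * int h) / real q"] by (intro mult_left_mono) auto
    then show "\<bar>j h\<bar> \<le> int q"
      by linarith
    have "\<bar>real_of_int (x h)\<bar> \<le> real q * 1"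
      unfolding x_eq
    proof (intro mult_left_mono)
      have "1 / (2 * real m) \<le> 1"
        using assms(2) by simp
      then show "\<bar>of_int (v h) * (real h / real q) - of_int (u h)\<bar> \<le> 1"
        using u_v(4)[of h] by linarith
    qed auto
    then show "\<bar>x h\<bar> \<le> int q"
      by linarith
    have "[j h * v h = \<rho> * int h * v h] (mod int q)"
      by (intro cong_mult j_cong cong_refl)
    moreover have "[\<rho> * int h * v h = \<rho> * x h] (mod int q)"
      by (simp add: cong_iff_dvd_diff x_def algebra_simps)
    ultimately show "[j h * v h = \<rho> * x h] (mod int q)"
      by (rule cong_trans)
    show "B h \<ge> 0"
      by (simp add: B_def)
    show "B h \<le> real k"
      unfolding B_def by (rule norm_sum_unit_exp_le)
    have "B h * \<bar>real_of_int (j h)\<bar> = real q * (B h * int_dist (of_int (\<rho> * int h) / real q))"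
      unfolding j_eq by simp
    also have "\<dots> \<le> real q * 1"
      unfolding B_def by (intro mult_left_mono norm_sum_unit_exp_mult_int_dist_le) auto
    finally show "B h * \<bar>real_of_int (j h)\<bar> \<le> real q"
      by simp
  qed (use assms u_v in auto)
  define F where "F h = (\<Sum>a\<in>{a \<in> {1..m}. nat (v h) dvd a}.
    norm (\<Sum>b=1..n. unit_exp (real b * (real a * (real h / real q)))))" for h
  have app: "\<bar>real (nat (v h)) * (real h / real q) - of_int (u h)\<bar> < 1 / (2 * real m)" for h
    using u_v(2,4)[of h] by simp
  have F_nonneg: "F h \<ge> 0" for h
    by (simp add: F_def sum_nonneg)
  have F_le: "F h \<le> real n * real m / of_int (v h)" for h
    using sum_norm_unit_exp_multiples_bounds(1)[OF assms(2) _ app[of h], where n = n] u_v(2)[of h]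
    by (simp add: F_def)
  have F_sq: "(F h)\<^sup>2 * \<bar>real_of_int (x h)\<bar> \<le> 4 * real n * real m * real q / of_int (v h)" for h
  proof -
    have "(F h)\<^sup>2 * \<bar>of_int (v h) * (real h / real q) - of_int (u h)\<bar> \<le> 4 * real n * real m / of_int (v h)"
      using sum_norm_unit_exp_multiples_bounds(2)[OF assms(2) _ app[of h], where n = n] u_v(2)[of h]
      by (simp add: F_def)
    then have "real q * ((F h)\<^sup>2 * \<bar>of_int (v h) * (real h / real q) - of_int (u h)\<bar>)
        \<le> real q * (4 * real n * real m / of_int (v h))"
      by (intro mult_left_mono) auto
    then show ?thesis
      unfolding x_eq by (simp add: mult_ac)
  qed
  have A_le: "A h \<le> F h + 12 * real m * L" for h
  proof -
    have "A h = F h + (\<Sum>a\<in>{a \<in> {1..m}. \<not> nat (v h) dvd a}.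
        norm (\<Sum>b=1..n. unit_exp (real b * (real a * (real h / real q)))))"
      unfolding A_def F_def by (subst sum.union_disjoint[symmetric]) (auto intro!: sum.cong)
    also have "(\<Sum>a\<in>{a \<in> {1..m}. \<not> nat (v h) dvd a}.
        norm (\<Sum>b=1..n. unit_exp (real b * (real a * (real h / real q))))) \<le> 12 * real m * harm (2 * m)"
      using u_v(1,2,3)[of h] app[of h] assms(2)
      by (intro sum_norm_unit_exp_nonmultiples_bound) auto
    also have "\<dots> \<le> 12 * real m * L"
      using harm_mono[of "2 * m" "2 * m + 1", where 'a = real] L by (intro mult_left_mono) auto
    finally show ?thesis by simp
  qed
  \<comment> \<open>The constant 288 is \<open>2 * 12\<^sup>2\<close>, from squaring the two parts
    of \<open>A_le\<close>.\<close>
  have AB: "(A h * B h)\<^sup>2 \<le> 2 * ((F h)\<^sup>2 * (B h)\<^sup>2) + 288 * (real m)\<^sup>2 * L\<^sup>2 * (B h)\<^sup>2" for h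
  proof -
    have "(A h)\<^sup>2 \<le> (F h + 12 * real m * L)\<^sup>2"
      by (intro power_mono A_le) (simp add: A_def sum_nonneg)
    also have "\<dots> \<le> 2 * (F h)\<^sup>2 + 2 * (12 * real m * L)\<^sup>2"
      by (rule power2_sum_le)
    finally have "(A h)\<^sup>2 * (B h)\<^sup>2 \<le> (2 * (F h)\<^sup>2 + 2 * (12 * real m * L)\<^sup>2) * (B h)\<^sup>2"
      by (intro mult_right_mono) auto
    then show ?thesis
      by (simp add: power_mult_distrib algebra_simps)
  qed
  \<comment> \<open>An exact approximation leaves only the trivial bound for \<open>F h\<close>; its
    factor \<open>1 / v h\<close> supplies the weight in the sum over exact frequencies.\<close>
  have E: "(\<Sum>h\<in>{h \<in> {1..<q}. x h = 0}. (F h)\<^sup>2 * (B h)\<^sup>2) \<le> 4 * (real n * real m)\<^sup>2 * real k * L\<^sup>2"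
  proof -
    have "(\<Sum>h\<in>{h \<in> {1..<q}. x h = 0}. (F h)\<^sup>2 * (B h)\<^sup>2)
        \<le> (\<Sum>h\<in>{h \<in> {1..<q}. x h = 0}. (real n * real m)\<^sup>2 * ((B h)\<^sup>2 / (of_int (v h))\<^sup>2))"
    proof (rule sum_mono)
      fix h
      have "(F h)\<^sup>2 \<le> (real n * real m / of_int (v h))\<^sup>2"
        by (intro power_mono F_le F_nonneg)
      then have "(F h)\<^sup>2 * (B h)\<^sup>2 \<le> (real n * real m / of_int (v h))\<^sup>2 * (B h)\<^sup>2"
        by (intro mult_right_mono) auto
      then show "(F h)\<^sup>2 * (B h)\<^sup>2 \<le> (real n * real m)\<^sup>2 * ((B h)\<^sup>2 / (of_int (v h))\<^sup>2)"
        by (simp add: power_divide)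
    qed
    also have "\<dots> \<le> (real n * real m)\<^sup>2 * (4 * real k * (harm (2 * m))\<^sup>2)"
      unfolding sum_distrib_left[symmetric] by (intro mult_left_mono sum_exact_frequencies_le) auto
    also have "\<dots> \<le> (real n * real m)\<^sup>2 * (4 * real k * L\<^sup>2)"
      using harm_mono[of "2 * m" "2 * m + 1", where 'a = real] L
      by (intro mult_left_mono power_mono) (auto simp: harm_nonneg)
    finally show ?thesis by simp
  qed
  have "D \<ge> 0"
    using D[of 1] assms(1,2) of_nat_0_le_iff order_trans by fastforce
  \<comment> \<open>Dividing \<open>F_sq\<close> by \<open>\<bar>x h\<bar>\<close> supplies the
    weight \<open>1 / (v h * \<bar>x h\<bar>)\<close>.\<close>
  have I: "(\<Sum>h\<in>{h \<in> {1..<q}. x h \<noteq> 0}. (F h)\<^sup>2 * (B h)\<^sup>2)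
      \<le> 192 * D * real n * real m * real q * (real k)\<^sup>2 * L\<^sup>2"
  proof -
    have "(\<Sum>h\<in>{h \<in> {1..<q}. x h \<noteq> 0}. (F h)\<^sup>2 * (B h)\<^sup>2)
        \<le> (\<Sum>h\<in>{h \<in> {1..<q}. x h \<noteq> 0}. 4 * real n * real m * real q
              * ((B h)\<^sup>2 / (real_of_int (v h) * \<bar>real_of_int (x h)\<bar>)))"
    proof (rule sum_mono)
      fix h assume "h \<in> {h \<in> {1..<q}. x h \<noteq> 0}"
      then have "(F h)\<^sup>2 \<le> 4 * real n * real m * real q / of_int (v h) / \<bar>real_of_int (x h)\<bar>"
        using F_sq[of h] by (subst pos_le_divide_eq) auto
      then have "(F h)\<^sup>2 * (B h)\<^sup>2 \<le> 4 * real n * real m * real q / of_int (v h) / \<bar>real_of_int (x h)\<bar> * (B h)\<^sup>2"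
        by (intro mult_right_mono) auto
      then show "(F h)\<^sup>2 * (B h)\<^sup>2 \<le> 4 * real n * real m * real q
              * ((B h)\<^sup>2 / (real_of_int (v h) * \<bar>real_of_int (x h)\<bar>))"
        by (simp add: mult_ac)
    qed
    also have "\<dots> \<le> 4 * real n * real m * real q * (48 * D * (real k)\<^sup>2 * harm q * harm (2 * m + 1))"
      unfolding sum_distrib_left[symmetric]
      by (intro mult_left_mono sum_inexact_frequencies_le assms(2) D) auto
    also have "\<dots> \<le> 4 * real n * real m * real q * (48 * D * (real k)\<^sup>2 * L * L)"
      using L L1 \<open>D \<ge> 0\<close> by (intro mult_left_mono mult_mono) (auto simp: harm_nonneg)
    finally show ?thesis by (simp add: power2_eq_square mult_ac)
  qed
  have "(\<Sum>h=1..<q. (F h)\<^sup>2 * (B h)\<^sup>2)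
      = (\<Sum>h\<in>{h \<in> {1..<q}. x h = 0}. (F h)\<^sup>2 * (B h)\<^sup>2) + (\<Sum>h\<in>{h \<in> {1..<q}. x h \<noteq> 0}. (F h)\<^sup>2 * (B h)\<^sup>2)"
    by (subst sum.union_disjoint[symmetric]) (auto intro!: sum.cong)
  with E I have FB: "(\<Sum>h=1..<q. (F h)\<^sup>2 * (B h)\<^sup>2)
      \<le> 4 * (real n * real m)\<^sup>2 * real k * L\<^sup>2 + 192 * D * real n * real m * real q * (real k)\<^sup>2 * L\<^sup>2"
    by linarith
  have "(\<Sum>h=1..<q. (B h)\<^sup>2) \<le> 2 * real k * real q * harm q"
    by (rule sum_B_square_le)
  also have "\<dots> \<le> 2 * real k * real q * L"
    using L by (intro mult_left_mono) auto
  finally have BB: "288 * (real m)\<^sup>2 * L\<^sup>2 * (\<Sum>h=1..<q. (B h)\<^sup>2) \<le> 288 * (real m)\<^sup>2 * L\<^sup>2 * (2 * real k * real q * L)"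
    by (intro mult_left_mono) auto
  have "(\<Sum>h=1..<q. (A h * B h)\<^sup>2)
      \<le> (\<Sum>h=1..<q. 2 * ((F h)\<^sup>2 * (B h)\<^sup>2) + 288 * (real m)\<^sup>2 * L\<^sup>2 * (B h)\<^sup>2)"
    by (intro sum_mono AB)
  also have "\<dots> = 2 * (\<Sum>h=1..<q. (F h)\<^sup>2 * (B h)\<^sup>2) + 288 * (real m)\<^sup>2 * L\<^sup>2 * (\<Sum>h=1..<q. (B h)\<^sup>2)"
    by (simp add: sum.distrib sum_distrib_left)
  also have "\<dots> \<le> 2 * (4 * (real n * real m)\<^sup>2 * real k * L\<^sup>2 + 192 * D * real n * real m * real q * (real k)\<^sup>2 * L\<^sup>2)
      + 288 * (real m)\<^sup>2 * L\<^sup>2 * (2 * real k * real q * L)"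
    by (intro add_mono mult_left_mono FB BB) auto
  also have "\<dots> = 8 * (real n * real m)\<^sup>2 * real k * L\<^sup>2 + 384 * D * real n * real m * real q * (real k)\<^sup>2 * L\<^sup>2
      + 576 * (real m)\<^sup>2 * real k * real q * L ^ 3"
    by (simp add: power2_eq_square power3_eq_cube algebra_simps)
  finally show ?thesis .
qed

text \<open>The phase is a function of \<open>(a, b)\<close> plus a function of \<open>r\<close>, so
  the triple sum factorises; the triangle inequality is then applied over \<open>a\<close>.\<close>

lemma norm_triple_exponential_sum_le:
  fixes h k m n q :: nat and \<rho> :: int
  shows "norm (\<Sum>i\<in>{1..k} \<times> {1..m} \<times> {1..n}.
      unit_exp (real h * (of_int (case i of (r, a, b) \<Rightarrow> int (a * b) - \<rho> * int r) / real q)))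
    \<le> (\<Sum>a=1..m. norm (\<Sum>b=1..n. unit_exp (real b * (real a * (real h / real q)))))
      * norm (\<Sum>r=1..k. unit_exp (real r * (of_int (\<rho> * int h) / real q)))"
proof -
  define E where "E a b = unit_exp (real b * (real a * (real h / real q)))" for a b
  define U where "U r = unit_exp (real r * (of_int (\<rho> * int h) / real q))" for r
  have split: "unit_exp (real h * (of_int (int (a * b) - \<rho> * int r) / real q)) = cnj (U r) * E a b"
    for r a b
  proof -
    have "real h * (of_int (int (a * b) - \<rho> * int r) / real q)
      = - (real r * (of_int (\<rho> * int h) / real q)) + real b * (real a * (real h / real q))"
      by (simp add: field_simps diff_divide_distrib)
    then show ?thesis
      by (simp only: unit_exp_add unit_exp_uminus U_def E_def)
  qed
  have "(\<Sum>i\<in>{1..k} \<times> {1..m} \<times> {1..n}.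
      unit_exp (real h * (of_int (case i of (r, a, b) \<Rightarrow> int (a * b) - \<rho> * int r) / real q)))
    = (\<Sum>r=1..k. \<Sum>a=1..m. \<Sum>b=1..n. cnj (U r) * E a b)"
    unfolding sum.cartesian_product
    by (intro sum.cong refl) (simp only: split case_prod_unfold)
  also have "\<dots> = cnj (\<Sum>r=1..k. U r) * (\<Sum>a=1..m. \<Sum>b=1..n. E a b)"
    unfolding cnj_sum sum_distrib_right by (simp only: sum_distrib_left)
  finally have "norm (\<Sum>i\<in>{1..k} \<times> {1..m} \<times> {1..n}.
      unit_exp (real h * (of_int (case i of (r, a, b) \<Rightarrow> int (a * b) - \<rho> * int r) / real q)))
    = norm (\<Sum>a=1..m. \<Sum>b=1..n. E a b) * norm (\<Sum>r=1..k. U r)"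
    by (simp only: norm_mult complex_mod_cnj mult.commute)
  also have "\<dots> \<le> (\<Sum>a=1..m. norm (\<Sum>b=1..n. E a b)) * norm (\<Sum>r=1..k. U r)"
    by (intro mult_right_mono norm_sum norm_ge_zero)
  finally show ?thesis
    unfolding E_def U_def .
qed

section \<open>The variance of the divisor sums\<close>

text \<open>The variance identity is applied to the triples \<open>(r, a, b)\<close> with the
  residue \<open>a * b - \<rho> * r\<close>. The mean here uses the integer cutoffs
  \<open>k\<close>, \<open>m\<close>, \<open>n\<close>.\<close>

lemma sum_deviation_square_le:
  fixes q k m n :: nat and \<rho> :: int and D L :: real
  assumes "q > 0" "m > 0" "coprime \<rho> (int q)"
    and D: "\<And>l. 0 < l \<Longrightarrow> l \<le> 2 * m * q \<Longrightarrow> real (card {d. d dvd l}) \<le> D"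
    and L: "harm q \<le> L" "harm (2 * m + 1) \<le> L"
  defines "S \<equiv> \<lambda>s. card {i \<in> {1..k} \<times> {1..m} \<times> {1..n}.
    [case i of (r, a, b) \<Rightarrow> int (a * b) - \<rho> * int r = int s] (mod int q)}"
  shows "(\<Sum>s=1..q. (real (S s) - real (k * m * n) / real q)\<^sup>2)
    \<le> (8 * (real n * real m)\<^sup>2 * real k * L\<^sup>2 + 384 * D * real n * real m * real q * (real k)\<^sup>2 * L\<^sup>2
      + 576 * (real m)\<^sup>2 * real k * real q * L ^ 3) / real q"
proof -
  have "(\<Sum>s=1..q. (real (S s) - real (k * m * n) / real q)\<^sup>2)
    = (\<Sum>h=1..<q. (norm (\<Sum>i\<in>{1..k} \<times> {1..m} \<times> {1..n}.
        unit_exp (real h * (of_int (case i of (r, a, b) \<Rightarrow> int (a * b) - \<rho> * int r) / real q))))\<^sup>2) / real q"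
    unfolding S_def
    using sum_variance_residues[of "{1..k} \<times> {1..m} \<times> {1..n}" q "\<lambda>(r, a, b). int (a * b) - \<rho> * int r"] assms(1)
    by (simp add: card_cartesian_product mult.assoc)
  also have "\<dots> \<le> (\<Sum>h=1..<q. ((\<Sum>a=1..m. norm (\<Sum>b=1..n. unit_exp (real b * (real a * (real h / real q)))))
      * norm (\<Sum>r=1..k. unit_exp (real r * (of_int (\<rho> * int h) / real q))))\<^sup>2) / real q"
    by (intro divide_right_mono sum_mono power_mono norm_triple_exponential_sum_le) auto
  also have "\<dots> \<le> (8 * (real n * real m)\<^sup>2 * real k * L\<^sup>2 + 384 * D * real n * real m * real q * (real k)\<^sup>2 * L\<^sup>2
      + 576 * (real m)\<^sup>2 * real k * real q * L ^ 3) / real q"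
    using assms(1) by (intro divide_right_mono sum_exponential_sums_square_le assms) auto
  finally show ?thesis .
qed

section \<open>From truncated divisor sums to counts of triples\<close>

lemma nat_le_real_iff_le_nat_floor: "1 \<le> a \<and> real a \<le> M \<longleftrightarrow> a \<in> {1..nat \<lfloor>M\<rfloor>}"
proof -
  have "real a \<le> M \<longleftrightarrow> int a \<le> \<lfloor>M\<rfloor>"
    by (simp add: le_floor_iff)
  then show ?thesis
    by auto
qed

lemma tau_progression_sum_eq_card:
  "tau_progression_sum M N q a
    = real (card {(b, c) \<in> {1..nat \<lfloor>M\<rfloor>} \<times> {1..nat \<lfloor>N\<rfloor>}. [int (b * c) = a] (mod int q)})"
proof -
  define P where "P = {1..nat \<lfloor>M\<rfloor>} \<times> {1..nat \<lfloor>N\<rfloor>}"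
  define f where "f p = fst p * snd p" for p :: "nat \<times> nat"
  define R where "R = {t :: nat. 1 \<le> t \<and> [int t = a] (mod int q)}"
  have fin: "finite P" by (simp add: P_def)
  have tau: "real (tau_trunc M N t) = (\<Sum>p\<in>P. of_bool (f p = t))" for t
  proof -
    have "{(b, c). 1 \<le> b \<and> 1 \<le> c \<and> real b \<le> M \<and> real c \<le> N \<and> b * c = t} = {p \<in> P. f p = t}"
    proof (rule set_eqI)
      fix p :: "nat \<times> nat"
      show "p \<in> {(b, c). 1 \<le> b \<and> 1 \<le> c \<and> real b \<le> M \<and> real c \<le> N \<and> b * c = t} \<longleftrightarrow> p \<in> {p \<in> P. f p = t}"
        using nat_le_real_iff_le_nat_floor[of "fst p" M] nat_le_real_iff_le_nat_floor[of "snd p" N]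
        unfolding P_def f_def mem_Collect_eq case_prod_unfold mem_Times_iff by blast
    qed
    then show ?thesis
      unfolding tau_trunc_def using fin by (simp add: sum.If_cases of_bool_def Int_def)
  qed
  have "tau_progression_sum M N q a = (\<Sum>\<^sub>\<infinity>t\<in>R. real (tau_trunc M N t))"
    by (simp add: tau_progression_sum_def R_def)
  also have "\<dots> = (\<Sum>\<^sub>\<infinity>t\<in>R \<inter> f ` P. real (tau_trunc M N t))"
    by (rule infsum_cong_neutral) (auto simp: tau intro!: sum.neutral)
  also have "\<dots> = (\<Sum>t\<in>R \<inter> f ` P. \<Sum>p\<in>P. of_bool (f p = t))"
    using fin by (simp add: tau)
  also have "\<dots> = (\<Sum>p\<in>P. \<Sum>t\<in>R \<inter> f ` P. of_bool (f p = t))"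
    by (rule sum.swap)
  also have "\<dots> = (\<Sum>p\<in>P. of_bool ([int (f p) = a] (mod int q)))"
  proof (rule sum.cong)
    fix p assume p: "p \<in> P"
    then have "f p \<in> R \<longleftrightarrow> [int (f p) = a] (mod int q)"
      by (auto simp: R_def f_def P_def)
    moreover have "(\<Sum>t\<in>R \<inter> f ` P. of_bool (f p = t)) = (of_bool (f p \<in> R \<inter> f ` P) :: real)"
      using fin by (simp add: of_bool_def)
    ultimately show "(\<Sum>t\<in>R \<inter> f ` P. of_bool (f p = t)) = (of_bool ([int (f p) = a] (mod int q)) :: real)"
      using p by simp
  qed auto
  also have "\<dots> = real (card {p \<in> P. [int (f p) = a] (mod int q)})"
    using fin by (simp add: sum.If_cases of_bool_def Int_def)
  finally show ?thesis
    by (simp add: P_def f_def case_prod_unfold mem_Times_iff conj_assoc)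
qed

lemma sum_tau_progression_sum_eq_card:
  "(\<Sum>r \<in> {r :: nat. 1 \<le> r \<and> real r \<le> K}. tau_progression_sum M N q (\<rho> * int r + int s))
    = real (card {i \<in> {1..nat \<lfloor>K\<rfloor>} \<times> {1..nat \<lfloor>M\<rfloor>} \<times> {1..nat \<lfloor>N\<rfloor>}.
        [case i of (r, a, b) \<Rightarrow> int (a * b) - \<rho> * int r = int s] (mod int q)})"
proof -
  have cong: "[int (a * b) = \<rho> * int r + int s] (mod int q) \<longleftrightarrow> [int (a * b) - \<rho> * int r = int s] (mod int q)"
    for a b r
    by (simp add: cong_iff_dvd_diff algebra_simps)
  have "{r :: nat. 1 \<le> r \<and> real r \<le> K} = {1..nat \<lfloor>K\<rfloor>}"
    using nat_le_real_iff_le_nat_floor[of _ K] by blast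
  then have "(\<Sum>r \<in> {r :: nat. 1 \<le> r \<and> real r \<le> K}. tau_progression_sum M N q (\<rho> * int r + int s))
    = real (\<Sum>r=1..nat \<lfloor>K\<rfloor>. card {(a, b) \<in> {1..nat \<lfloor>M\<rfloor>} \<times> {1..nat \<lfloor>N\<rfloor>}. [int (a * b) - \<rho> * int r = int s] (mod int q)})"
    by (simp only: tau_progression_sum_eq_card cong of_nat_sum)
  also have "(\<Sum>r=1..nat \<lfloor>K\<rfloor>. card {(a, b) \<in> {1..nat \<lfloor>M\<rfloor>} \<times> {1..nat \<lfloor>N\<rfloor>}. [int (a * b) - \<rho> * int r = int s] (mod int q)})
    = card (SIGMA r:{1..nat \<lfloor>K\<rfloor>}. {(a, b) \<in> {1..nat \<lfloor>M\<rfloor>} \<times> {1..nat \<lfloor>N\<rfloor>}. [int (a * b) - \<rho> * int r = int s] (mod int q)})"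
    by (rule card_SigmaI[symmetric])
      (auto intro: finite_subset[of _ "{1..nat \<lfloor>M\<rfloor>} \<times> {1..nat \<lfloor>N\<rfloor>}"])
  also have "(SIGMA r:{1..nat \<lfloor>K\<rfloor>}. {(a, b) \<in> {1..nat \<lfloor>M\<rfloor>} \<times> {1..nat \<lfloor>N\<rfloor>}. [int (a * b) - \<rho> * int r = int s] (mod int q)})
    = {i \<in> {1..nat \<lfloor>K\<rfloor>} \<times> {1..nat \<lfloor>M\<rfloor>} \<times> {1..nat \<lfloor>N\<rfloor>}.
        [case i of (r, a, b) \<Rightarrow> int (a * b) - \<rho> * int r = int s] (mod int q)}"
    by auto
  finally show ?thesis .
qed

theorem theorem4p5:
  fixes c1 c2 \<eta> \<delta> \<epsilon> :: real
  assumes "0 < c1" and "0 < c2" and "0 < \<eta>" and "0 < \<delta>" and "0 < \<epsilon>"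
  shows "\<exists>C > 0. \<forall>(K :: real) (M :: real) (N :: real) (q :: nat) (\<rho> :: int).
    1 \<le> K \<longrightarrow> 1 \<le> M \<longrightarrow> 1 \<le> N \<longrightarrow> 1 \<le> q \<longrightarrow>
    c1 * N \<le> M \<longrightarrow> M \<le> c2 * N \<longrightarrow>
    N powr \<eta> \<le> K \<longrightarrow>
    real q \<le> N powr (2 - \<delta>) \<longrightarrow>
    coprime \<rho> (int q) \<longrightarrow>
    (\<Sum>s = 1..q.
       ((\<Sum>r \<in> {r :: nat. 1 \<le> r \<and> real r \<le> K}.
           tau_progression_sum M N q (\<rho> * int r + int s))
         - K * M * N / real q)\<^sup>2)
    \<le> C * (K\<^sup>2 * N powr (max (7 / 2) (max (4 - \<delta>) (4 - \<eta>)) + \<epsilon>) / real q)"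
proof -
  \<comment> \<open>The losses amount to \<open>R ^ 3\<close> with \<open>R = T powr a\<close> and
    \<open>T\<close> of order at most \<open>N powr 3\<close>, hence to
    \<open>N powr (9 * a)\<close>. The cap 1 is for \<open>harm_le_powr\<close>.\<close>
  define a where "a = min 1 (\<epsilon> / 9)"
  have a: "0 < a" "a \<le> 1" "9 * a \<le> \<epsilon>"
    using assms by (auto simp: a_def)
  obtain Cd where Cd: "Cd \<ge> 1" "\<And>l. l > 0 \<Longrightarrow> real (card {d::nat. d dvd l}) \<le> Cd * real l powr a"
    using card_divisors_bound[OF a(1)] by blast
  define E where "E = max (7 / 2) (max (4 - \<delta>) (4 - \<eta>))"
  define \<kappa> where "\<kappa> = 2 / a"
  \<comment> \<open>\<open>C1\<close> collects the three terms of the variance bound after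
    \<open>n \<le> N\<close> and \<open>m \<le> c2 * N\<close>; \<open>C2\<close> comes from
    replacing the real cutoffs by their floors in the mean.\<close>
  define C1 where "C1 = 8 * c2\<^sup>2 * \<kappa>\<^sup>2 + 384 * Cd * c2 * \<kappa>\<^sup>2 + 576 * c2\<^sup>2 * \<kappa> ^ 3"
  define C2 where "C2 = 2 * c2\<^sup>2 + 2 * (1 + c2)\<^sup>2"
  define C where "C = 2 * C1 * (2 * c2 + 1) powr (3 * a) + 2 * C2"
  have "\<kappa> > 0" using a by (simp add: \<kappa>_def)
  have "C1 > 0"
    using \<open>\<kappa> > 0\<close> assms(2) Cd(1) by (auto simp: C1_def intro!: add_pos_pos mult_pos_pos)
  have "C2 > 0"
    using assms(2) by (auto simp: C2_def intro!: add_pos_pos mult_pos_pos)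
  have "C > 0"
    using \<open>C1 > 0\<close> \<open>C2 > 0\<close> assms(2) by (auto simp: C_def intro!: add_pos_pos mult_pos_pos)
  moreover have "(\<Sum>s = 1..q. ((\<Sum>r \<in> {r :: nat. 1 \<le> r \<and> real r \<le> K}.
        tau_progression_sum M N q (\<rho> * int r + int s)) - K * M * N / real q)\<^sup>2)
      \<le> C * (K\<^sup>2 * N powr (E + \<epsilon>) / real q)"
    if K: "1 \<le> K" and M: "1 \<le> M" and N: "1 \<le> N" and "1 \<le> q" and MN: "M \<le> c2 * N"
      and \<eta>: "N powr \<eta> \<le> K" and q_le: "real q \<le> N powr (2 - \<delta>)" and cop: "coprime \<rho> (int q)"
    for K M N :: real and q :: nat and \<rho> :: int
  proof -
    define k m n where "k = nat \<lfloor>K\<rfloor>" and "m = nat \<lfloor>M\<rfloor>" and "n = nat \<lfloor>N\<rfloor>"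
    have k: "real k \<le> K" "K \<le> real k + 1" and m: "real m \<le> M" "M \<le> real m + 1" "1 \<le> m"
      and n: "real n \<le> N" "N \<le> real n + 1"
      using K M N unfolding k_def m_def n_def by linarith+
    have "m > 0" "q > 0" using m(3) \<open>1 \<le> q\<close> by auto
    have mN: "real m \<le> c2 * N" using m MN by linarith
    \<comment> \<open>\<open>T\<close> exceeds \<open>2 * m * q\<close> and is at least
      \<open>q\<close> and \<open>2 * m + 1\<close>, so one quantity \<open>R\<close> controls the
      divisor counts and both harmonic numbers.\<close>
    define T where "T = q * (2 * m + 1)"
    define R where "R = real T powr a"
    define X where "X = K\<^sup>2 * N powr E"
    have "T > 0" using \<open>q > 0\<close> by (simp add: T_def)
    have "R \<ge> 1"
      using \<open>T > 0\<close> a ge_one_powr_ge_zero[of "real T" a] by (simp add: R_def)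
    have harm: "harm t \<le> \<kappa> * R" if "t \<le> T" for t
      using harm_le_powr[OF a(1,2) \<open>T > 0\<close>] harm_mono[OF that, where 'a = real]
      by (simp add: \<kappa>_def R_def)
    have div: "real (card {d. d dvd l}) \<le> Cd * R" if "0 < l" "l \<le> 2 * m * q" for l
    proof -
      have "l \<le> T" using that by (simp add: T_def algebra_simps)
      then have "real l powr a \<le> R"
        unfolding R_def using a by (intro powr_mono2) auto
      then have "Cd * real l powr a \<le> Cd * R"
        using Cd(1) by (intro mult_left_mono) auto
      then show ?thesis using Cd(2)[OF that(1)] by linarith
    qed
    have N_powr_le: "N powr e \<le> N powr E" if "e \<le> E" for e
      using N that by (intro powr_mono) auto
    \<comment> \<open>The lower bound for \<open>K\<close> enters here: one factor
      \<open>N powr \<eta>\<close> is exchanged for \<open>K\<close>.\<close>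
    have X1: "N ^ 4 * K \<le> X"
    proof -
      have "N ^ 4 = N powr (4 - \<eta>) * N powr \<eta>"
        using N by (simp flip: powr_add add: powr_numeral)
      also have "\<dots> \<le> N powr E * K"
        using \<eta> by (intro mult_mono N_powr_le) (auto simp: E_def)
      finally have "N ^ 4 * K \<le> N powr E * K * K"
        using K by (intro mult_right_mono) auto
      then show ?thesis by (simp add: X_def power2_eq_square mult_ac)
    qed
    \<comment> \<open>The upper bound for \<open>q\<close> enters here and gives the exponent
      \<open>4 - \<delta>\<close>.\<close>
    have X2: "N\<^sup>2 * real q * K\<^sup>2 \<le> X"
    proof -
      have "N\<^sup>2 * real q \<le> N\<^sup>2 * N powr (2 - \<delta>)"
        using q_le by (intro mult_left_mono) auto
      also have "\<dots> = N powr (4 - \<delta>)"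
        using N by (simp flip: powr_numeral powr_add)
      also have "\<dots> \<le> N powr E"
        by (intro N_powr_le) (simp add: E_def)
      finally have "N\<^sup>2 * real q * K\<^sup>2 \<le> N powr E * K\<^sup>2"
        by (intro mult_right_mono) auto
      then show ?thesis by (simp add: X_def mult_ac)
    qed
    have X3: "K\<^sup>2 * N\<^sup>2 \<le> X"
    proof -
      have "N\<^sup>2 = N powr 2" using N by (simp add: powr_numeral)
      also have "\<dots> \<le> N powr E" by (intro N_powr_le) (simp add: E_def)
      finally show ?thesis unfolding X_def by (intro mult_left_mono) auto
    qed
    have "X \<ge> 0" by (simp add: X_def)
    have "K \<le> K\<^sup>2" using K by (simp add: power2_eq_square)
    have t1: "(real n * real m)\<^sup>2 * real k \<le> c2\<^sup>2 * X"
    proof -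
      have "(real n * real m)\<^sup>2 * real k \<le> (N * (c2 * N))\<^sup>2 * K"
        using k n mN N assms(2) by (intro mult_mono power_mono) auto
      also have "\<dots> = c2\<^sup>2 * (N ^ 4 * K)"
        by (simp add: power2_eq_square power4_eq_xxxx)
      finally show ?thesis using X1 by (smt (verit) mult_left_mono zero_le_power2)
    qed
    have t2: "real n * real m * real q * (real k)\<^sup>2 \<le> c2 * X"
    proof -
      have "real n * real m * real q * (real k)\<^sup>2 \<le> N * (c2 * N) * real q * K\<^sup>2"
        using k n mN N assms(2) by (intro mult_mono power_mono) auto
      also have "\<dots> = c2 * (N\<^sup>2 * real q * K\<^sup>2)"
        by (simp add: power2_eq_square)
      also have "\<dots> \<le> c2 * X"
        using X2 assms(2) by (intro mult_left_mono) auto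
      finally show ?thesis .
    qed
    have t3: "(real m)\<^sup>2 * real k * real q \<le> c2\<^sup>2 * X"
    proof -
      have "(real m)\<^sup>2 * real k * real q \<le> (c2 * N)\<^sup>2 * K\<^sup>2 * real q"
        using k mN N assms(2) \<open>K \<le> K\<^sup>2\<close> by (intro mult_mono power_mono) auto
      also have "\<dots> = c2\<^sup>2 * (N\<^sup>2 * real q * K\<^sup>2)"
        by (simp add: power2_eq_square)
      also have "\<dots> \<le> c2\<^sup>2 * X"
        using X2 by (intro mult_left_mono) auto
      finally show ?thesis .
    qed
    define S where "S s = real (card {i \<in> {1..k} \<times> {1..m} \<times> {1..n}.
      [case i of (r, a, b) \<Rightarrow> int (a * b) - \<rho> * int r = int s] (mod int q)})" for s
    define W where "W = 8 * (real n * real m)\<^sup>2 * real k * (\<kappa> * R)\<^sup>2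
      + 384 * (Cd * R) * real n * real m * real q * (real k)\<^sup>2 * (\<kappa> * R)\<^sup>2
      + 576 * (real m)\<^sup>2 * real k * real q * (\<kappa> * R) ^ 3"
    have dev: "(\<Sum>s=1..q. (S s - real (k * m * n) / real q)\<^sup>2) \<le> W / real q"
      unfolding S_def W_def
    proof (rule sum_deviation_square_le)
      have "q * 1 \<le> q * (2 * m + 1)" by (intro mult_left_mono) auto
      then show "harm q \<le> \<kappa> * R" by (intro harm) (simp add: T_def)
      have "1 * (2 * m + 1) \<le> q * (2 * m + 1)" using \<open>1 \<le> q\<close> by (intro mult_right_mono) auto
      then show "harm (2 * m + 1) \<le> \<kappa> * R" by (intro harm) (simp add: T_def)
    qed (use \<open>q > 0\<close> \<open>m > 0\<close> cop div in auto)
    have "R\<^sup>2 \<le> R ^ 3"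
      using \<open>R \<ge> 1\<close> by (intro power_increasing) auto
    have "W = ((real n * real m)\<^sup>2 * real k) * (8 * \<kappa>\<^sup>2 * R\<^sup>2)
        + (real n * real m * real q * (real k)\<^sup>2) * (384 * Cd * \<kappa>\<^sup>2 * R ^ 3)
        + ((real m)\<^sup>2 * real k * real q) * (576 * \<kappa> ^ 3 * R ^ 3)"
      by (simp add: W_def power2_eq_square power3_eq_cube)
    also have "\<dots> \<le> (c2\<^sup>2 * X) * (8 * \<kappa>\<^sup>2 * R ^ 3) + (c2 * X) * (384 * Cd * \<kappa>\<^sup>2 * R ^ 3)
        + (c2\<^sup>2 * X) * (576 * \<kappa> ^ 3 * R ^ 3)"
      by (rule add_mono[OF add_mono[OF mult_mono[OF t1] mult_right_mono[OF t2]] mult_right_mono[OF t3]])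
        (use \<open>R \<ge> 1\<close> \<open>\<kappa> > 0\<close> Cd(1) \<open>X \<ge> 0\<close> \<open>R\<^sup>2 \<le> R ^ 3\<close> in auto)
    also have "\<dots> = C1 * X * R ^ 3"
      by (simp add: C1_def algebra_simps)
    also have "\<dots> \<le> C1 * X * ((2 * c2 + 1) powr (3 * a) * N powr \<epsilon>)"
    proof (intro mult_left_mono)
      \<comment> \<open>The aim is \<open>T \<le> (2 * c2 + 1) * N powr 3\<close>, from
        \<open>q \<le> N powr 2\<close> and \<open>2 * m + 1 \<le> (2 * c2 + 1) * N\<close>; the
        latter uses \<open>N \<ge> 1\<close>.\<close>
      have "real q \<le> N powr 2"
        using q_le N assms(4) powr_mono[of "2 - \<delta>" 2 N] by linarith
      moreover have "real (2 * m + 1) \<le> (2 * c2 + 1) * N"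
        using mN N by (simp add: algebra_simps)
      ultimately have "real q * real (2 * m + 1) \<le> N powr 2 * ((2 * c2 + 1) * N)"
        by (intro mult_mono) auto
      also have "\<dots> = (2 * c2 + 1) * N powr 3"
        using N by (simp add: powr_numeral power2_eq_square power3_eq_cube)
      finally have "real T \<le> (2 * c2 + 1) * N powr 3"
        unfolding T_def of_nat_mult .
      then have "R \<le> ((2 * c2 + 1) * N powr 3) powr a"
        unfolding R_def using a by (intro powr_mono2) auto
      then have "R ^ 3 \<le> (((2 * c2 + 1) * N powr 3) powr a) ^ 3"
        using \<open>R \<ge> 1\<close> by (intro power_mono) auto
      also have "\<dots> = (((2 * c2 + 1) * N powr 3) powr a) powr 3"
        using N assms(2) by (subst powr_numeral) auto
      also have "\<dots> = (2 * c2 + 1) powr (3 * a) * N powr (9 * a)"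
        using N assms(2) by (simp add: powr_mult powr_powr mult_ac del: powr_numeral)
      also have "\<dots> \<le> (2 * c2 + 1) powr (3 * a) * N powr \<epsilon>"
        using N a by (intro mult_left_mono powr_mono) auto
      finally show "R ^ 3 \<le> (2 * c2 + 1) powr (3 * a) * N powr \<epsilon>" .
    qed (use \<open>C1 > 0\<close> \<open>X \<ge> 0\<close> in auto)
    finally have W_le: "W \<le> C1 * (2 * c2 + 1) powr (3 * a) * (X * N powr \<epsilon>)"
      by (simp add: mult_ac)
    define Z where "Z = K * M * N - real (k * m * n)"
    have "Z \<ge> 0"
    proof -
      have "real k * real m * real n \<le> K * M * N"
        using k m n K M N by (intro mult_mono) auto
      then show ?thesis by (simp add: Z_def)
    qed
    \<comment> \<open>The cutoffs are replaced by their floors one at a time, each change being at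
      most 1, so \<open>Z\<close> is of order at most \<open>N\<^sup>2 + K * N\<close>.\<close>
    have "Z = (K - real k) * (M * N) + real k * ((M - real m) * N) + real k * (real m * (N - real n))"
      by (simp add: Z_def algebra_simps)
    also have "\<dots> \<le> 1 * (c2 * N * N) + K * (1 * N) + K * (c2 * N * 1)"
      using k m n K M N MN mN assms(2) by (intro add_mono mult_mono) auto
    also have "\<dots> = c2 * N\<^sup>2 + (1 + c2) * (K * N)"
      by (simp add: power2_eq_square algebra_simps)
    finally have "Z\<^sup>2 \<le> (c2 * N\<^sup>2 + (1 + c2) * (K * N))\<^sup>2"
      using \<open>Z \<ge> 0\<close> by (intro power_mono) auto
    also have "\<dots> \<le> 2 * (c2 * N\<^sup>2)\<^sup>2 + 2 * ((1 + c2) * (K * N))\<^sup>2"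
      by (rule power2_sum_le)
    also have "\<dots> = 2 * c2\<^sup>2 * N ^ 4 + 2 * (1 + c2)\<^sup>2 * (K\<^sup>2 * N\<^sup>2)"
      by (simp add: power_mult_distrib flip: power_mult)
    also have "\<dots> \<le> 2 * c2\<^sup>2 * X + 2 * (1 + c2)\<^sup>2 * X"
    proof (intro add_mono mult_left_mono X3)
      have "N ^ 4 * 1 \<le> N ^ 4 * K" using K N by (intro mult_left_mono) auto
      then show "N ^ 4 \<le> X" using X1 by simp
    qed auto
    also have "\<dots> = C2 * (X * 1)"
      by (simp add: C2_def algebra_simps)
    also have "\<dots> \<le> C2 * (X * N powr \<epsilon>)"
      using \<open>C2 > 0\<close> \<open>X \<ge> 0\<close> N assms(5) by (intro mult_left_mono ge_one_powr_ge_zero) auto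
    finally have Z_le: "Z\<^sup>2 \<le> C2 * (X * N powr \<epsilon>)" .
    have "(\<Sum>s = 1..q. ((\<Sum>r \<in> {r :: nat. 1 \<le> r \<and> real r \<le> K}.
        tau_progression_sum M N q (\<rho> * int r + int s)) - K * M * N / real q)\<^sup>2)
      = (\<Sum>s = 1..q. (S s - K * M * N / real q)\<^sup>2)"
      unfolding sum_tau_progression_sum_eq_card S_def k_def m_def n_def ..
    also have "\<dots> \<le> (\<Sum>s = 1..q. 2 * (S s - real (k * m * n) / real q)\<^sup>2 + 2 * (Z / real q)\<^sup>2)"
    proof (rule sum_mono)
      fix s
      have "S s - K * M * N / real q = (S s - real (k * m * n) / real q) + - (Z / real q)"
        by (simp add: Z_def diff_divide_distrib)
      then show "(S s - K * M * N / real q)\<^sup>2 \<le> 2 * (S s - real (k * m * n) / real q)\<^sup>2 + 2 * (Z / real q)\<^sup>2"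
        using power2_sum_le[of "S s - real (k * m * n) / real q" "- (Z / real q)"]
        by (simp only: power2_minus)
    qed
    \<comment> \<open>The shift of the mean is \<open>Z / q\<close> in each of the \<open>q\<close>
      classes, so its squares add up to \<open>Z\<^sup>2 / q\<close>.\<close>
    also have "\<dots> = 2 * (\<Sum>s = 1..q. (S s - real (k * m * n) / real q)\<^sup>2) + 2 * (Z\<^sup>2 / real q)"
      using \<open>q > 0\<close> by (simp add: sum.distrib sum_distrib_left power_divide power2_eq_square)
    also have "\<dots> \<le> 2 * (W / real q) + 2 * (Z\<^sup>2 / real q)"
      using dev by simp
    also have "\<dots> = (2 * W + 2 * Z\<^sup>2) / real q"
      by (simp add: add_divide_distrib)
    also have "\<dots> \<le> (C * (X * N powr \<epsilon>)) / real q"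
      using W_le Z_le by (intro divide_right_mono) (auto simp: C_def algebra_simps)
    also have "\<dots> = C * (K\<^sup>2 * N powr (E + \<epsilon>) / real q)"
      by (simp add: X_def powr_add)
    finally show ?thesis .
  qed
  ultimately show ?thesis
    unfolding E_def by blast
qed

end
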